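(* Let $(\Sigma,\mathcal{T})$ be an ideally triangulated surface with boundary, and let $\eta:E\to(-1,+\infty)$ be a weight on the edges such that for every face $\{ijk\}\in F$ $$\eta_{ij}+\eta_{ik}\eta_{jk}\ge 0,\qquad \eta_{ik}+\eta_{ij}\eta_{jk}\ge 0,\qquad \eta_{jk}+\eta_{ij}\eta_{ik}\ge 0 .$$ Then the generalized combinatorial curvature $K:B\to(0,+\infty)$ uniquely determines the discrete conformal factor $u:B\to\mathbb{R}$; that is, if $u,u':B\to\mathbb{R}$ are two discrete conformal structures on $(\Sigma,\mathcal{T})$ (with the same weight $\eta$) having the same generalized combinatorial curvature, then $u=u'$.
   Context: Ideal triangulation: take a finite disjoint union of topological hexagons in each of which three pairwise non-adjacent edges are coloured red and the other three black; identify the red edges in pairs by homeomorphisms. The quotient is an ideally triangulated compact surface with boundary $(\Sigma,\mathcal{T})$. Faces are the images of the hexagons (set $F$), edges are the images of the red edges (set $E$), and the images of black edges are called boundary arcs; they make up the boundary of $\Sigma$, whose set of components is $B=\{1,\dots,n\}$. An edge joining boundary components $i,j$ is denoted $\{ij\}$, and a face adjacent to $i,j,k$ is denoted $\{ijk\}$. Discrete hyperbolic metric: any function $l:E\to(0,+\infty)$. Each face is realized as the (unique up to isometry) right-angled hyperbolic hexagon whose three red edges have the lengths prescribed by $l$; gluing these along the edges gives a hyperbolic metric on $\Sigma$ with totally geodesic boundary. The generalized combinatorial curvature $K_i$ of $l$ at $i\in B$ is the length of the boundary component $i$ in this metric. Discrete conformal structure: given $\eta:E\to(-1,+\infty)$,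 a discrete conformal structure on $(\Sigma,\mathcal{T})$ is a function $u:B\to\mathbb{R}$ (also called a discrete conformal factor) such that $$l_{ij}=\cosh^{-1}\Big(e^{u_i+u_j}+\eta_{ij}\sqrt{(1+e^{2u_i})(1+e^{2u_j})}\Big)$$ determines a discrete hyperbolic metric $l:E\to(0,+\infty)$ (i.e. the quantity in parentheses is $>1$ for every edge). The generalized combinatorial curvature of $u$ is that of the metric $l$ so determined. *)

theory Defs
  imports "HOL-Analysis.Analysis"
begin

section \<open>Ideally triangulated surfaces with boundary\<close>

text \<open>
  The hexagons are indexed by a finite type \<open>'f\<close>.  In the hexagon \<open>f\<close> the three red edges and the
  three black edges are both indexed by \<open>3\<close> (integers modulo 3), the red edge \<open>(f, i)\<close> being opposite
  to the black edge \<open>(f, i)\<close>.  Hence the red edge \<open>(f, i)\<close> runs from the black edge \<open>(f, i + 1)\<close> to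
  the black edge \<open>(f, i + 2)\<close>.

  Up to isotopy, a homeomorphism between two red edges is determined by what it does to the end points.
  So a gluing consists of \<open>glue\<close>, which sends a red edge to the one it is identified with, and
  \<open>crossed\<close>, which tells whether the identification sends the start of the first edge to the end of the
  second one (as happens for every edge when the cyclic orders orient the surface) or to its start.
\<close>

type_synonym 'f red_edge = "'f \<times> 3"
type_synonym 'f arc = "'f \<times> 3"

record 'f triangulation =
  glue :: "'f red_edge \<Rightarrow> 'f red_edge"
  crossed :: "'f red_edge \<Rightarrow> bool"

definition ideal_triangulation :: "'f::finite triangulation \<Rightarrow> bool" where
  "ideal_triangulation T \<longleftrightarrow>
     (\<forall>h. glue T h \<noteq> h \<and> glue T (glue T h) = h \<and> crossed T (glue T h) = crossed T h)"

definition edge_class :: "'f triangulation \<Rightarrow> 'f red_edge \<Rightarrow> 'f red_edge set" where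
  "edge_class T h = {h, glue T h}"

definition edges :: "'f triangulation \<Rightarrow> 'f red_edge set set" where
  "edges T = range (edge_class T)"

definition start_arc :: "'f red_edge \<Rightarrow> 'f arc" where
  "start_arc h = (fst h, snd h + 1)"

definition end_arc :: "'f red_edge \<Rightarrow> 'f arc" where
  "end_arc h = (fst h, snd h + 2)"

text \<open>
  Two boundary arcs are adjacent when the gluing identifies an end point of one with an end point of
  the other; the components of the boundary are the classes of the equivalence relation generated by
  adjacency, so a component is represented by the set of boundary arcs of which it consists.
\<close>

definition arc_adjacency :: "'f triangulation \<Rightarrow> ('f arc \<times> 'f arc) set" where
  "arc_adjacency T = (\<Union>h.
     if crossed T h
     then {(start_arc h, end_arc (glue T h)), (end_arc h, start_arc (glue T h))}
     else {(start_arc h, start_arc (glue T h)), (end_arc h, end_arc (glue T h))})"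

definition boundary_relation :: "'f triangulation \<Rightarrow> ('f arc \<times> 'f arc) set" where
  "boundary_relation T = (arc_adjacency T \<union> (arc_adjacency T)\<inverse>)\<^sup>*"

definition boundary_component :: "'f triangulation \<Rightarrow> 'f arc \<Rightarrow> 'f arc set" where
  "boundary_component T a = boundary_relation T `` {a}"

definition boundary_components :: "'f triangulation \<Rightarrow> 'f arc set set" where
  "boundary_components T = UNIV // boundary_relation T"


section \<open>Right-angled hexagons in the hyperbolic plane\<close>

text \<open>The hyperboloid model, for which the distance satisfies \<open>cosh d(x, y) = - \<langle>x, y\<rangle>\<close>.\<close>

definition lorentz :: "real^3 \<Rightarrow> real^3 \<Rightarrow> real" where
  "lorentz x y = x$1 * y$1 + x$2 * y$2 - x$3 * y$3"

definition hyp_plane :: "(real^3) set" where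
  "hyp_plane = {x. lorentz x x = -1 \<and> x$3 > 0}"

definition hyp_dist :: "real^3 \<Rightarrow> real^3 \<Rightarrow> real" where
  "hyp_dist x y = arcosh (- lorentz x y)"

text \<open>
  For \<open>x \<noteq> y\<close> in the hyperbolic plane, \<open>hyp_direction x y\<close> is the component of \<open>y\<close> that is
  Lorentz-orthogonal to \<open>x\<close>.  It is a positive multiple of the initial velocity of the geodesic
  segment from \<open>x\<close> to \<open>y\<close>.
\<close>

definition hyp_direction :: "real^3 \<Rightarrow> real^3 \<Rightarrow> real^3" where
  "hyp_direction x y = y + lorentz x y *\<^sub>R x"

definition right_angle :: "real^3 \<Rightarrow> real^3 \<Rightarrow> real^3 \<Rightarrow> bool" where
  "right_angle y x z \<longleftrightarrow> lorentz (hyp_direction x y) (hyp_direction x z) = 0"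

text \<open>
  The geodesic through \<open>x\<close> and \<open>y\<close> is cut out by the plane spanned by \<open>x\<close> and \<open>y\<close>, so the points \<open>v\<close> and
  \<open>w\<close> are strictly on the same side of it iff the two determinants have the same strict sign.
\<close>

definition same_side :: "real^3 \<Rightarrow> real^3 \<Rightarrow> real^3 \<Rightarrow> real^3 \<Rightarrow> bool" where
  "same_side x y v w \<longleftrightarrow> det (vector [x, y, v] :: real^3^3) * det (vector [x, y, w] :: real^3^3) > 0"

text \<open>
  The vertices are \<open>p 0, \<dots>, p 5\<close> in cyclic order, indexed by the integers modulo 6.  The last conjunct
  says that they are in convex position: for each side, the other four vertices are strictly on the same
  side of its line.  So each interior angle is \<open>\<pi> / 2\<close> and not \<open>3 \<pi> / 2\<close>, the vertices are distinct,
  and self-intersecting closed right-angled polygons are excluded.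
\<close>

definition right_angled_hexagon :: "(6 \<Rightarrow> real^3) \<Rightarrow> bool" where
  "right_angled_hexagon p \<longleftrightarrow>
     (\<forall>k. p k \<in> hyp_plane) \<and>
     (\<forall>k. right_angle (p (k - 1)) (p k) (p (k + 1))) \<and>
     (\<forall>k m n. m \<notin> {k, k + 1} \<and> n \<notin> {k, k + 1} \<longrightarrow> same_side (p k) (p (k + 1)) (p m) (p n))"

text \<open>
  The sides \<open>p 0 p 1\<close>, \<open>p 2 p 3\<close>, \<open>p 4 p 5\<close> are the black edges 0, 1, 2 and the sides \<open>p 3 p 4\<close>,
  \<open>p 5 p 0\<close>, \<open>p 1 p 2\<close> opposite to them are the red edges 0, 1, 2.  The black edge \<open>i\<close> starts at the
  vertex \<open>black_start i = 2 i\<close>.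
\<close>

definition black_start :: "3 \<Rightarrow> 6" where
  "black_start i = (if i = 0 then 0 else if i = 1 then 2 else 4)"

definition black_length :: "(6 \<Rightarrow> real^3) \<Rightarrow> 3 \<Rightarrow> real" where
  "black_length p i = hyp_dist (p (black_start i)) (p (black_start i + 1))"

definition red_length :: "(6 \<Rightarrow> real^3) \<Rightarrow> 3 \<Rightarrow> real" where
  "red_length p i = hyp_dist (p (black_start i + 3)) (p (black_start i + 4))"


section \<open>Discrete hyperbolic metrics and generalized combinatorial curvature\<close>

definition discrete_hyperbolic_metric :: "'f triangulation \<Rightarrow> ('f red_edge set \<Rightarrow> real) \<Rightarrow> bool" where
  "discrete_hyperbolic_metric T l \<longleftrightarrow> (\<forall>e\<in>edges T. l e > 0)"

definition face_hexagon :: "'f triangulation \<Rightarrow> ('f red_edge set \<Rightarrow> real) \<Rightarrow> 'f \<Rightarrow> (6 \<Rightarrow> real^3)" where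
  "face_hexagon T l f =
     (SOME p. right_angled_hexagon p \<and> (\<forall>i. red_length p i = l (edge_class T (f, i))))"

text \<open>
  A boundary component of the glued surface is a closed geodesic composed of its boundary arcs, so its
  length is the sum of theirs.
\<close>

definition curvature :: "'f::finite triangulation \<Rightarrow> ('f red_edge set \<Rightarrow> real) \<Rightarrow> 'f arc set \<Rightarrow> real" where
  "curvature T l b = (\<Sum>(f, i)\<in>b. black_length (face_hexagon T l f) i)"


section \<open>Discrete conformal structures\<close>

text \<open>
  The expression of which \<open>l\<^sub>i\<^sub>j\<close> is the inverse hyperbolic cosine, for an edge \<open>e\<close> joining the boundary
  components \<open>i\<close> and \<open>j\<close>.  It is symmetric in \<open>i\<close> and \<open>j\<close>, so it does not matter which of the two red
  edges in \<open>e\<close> serves to find them.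
\<close>

definition cosh_edge_length ::
  "'f triangulation \<Rightarrow> ('f red_edge set \<Rightarrow> real) \<Rightarrow> ('f arc set \<Rightarrow> real) \<Rightarrow> 'f red_edge set \<Rightarrow> real" where
  "cosh_edge_length T \<eta> u e =
     (let h = (SOME h. h \<in> e);
          ui = u (boundary_component T (start_arc h));
          uj = u (boundary_component T (end_arc h))
      in exp (ui + uj) + \<eta> e * sqrt ((1 + exp (2 * ui)) * (1 + exp (2 * uj))))"

definition conformal_metric ::
  "'f triangulation \<Rightarrow> ('f red_edge set \<Rightarrow> real) \<Rightarrow> ('f arc set \<Rightarrow> real) \<Rightarrow> 'f red_edge set \<Rightarrow> real" where
  "conformal_metric T \<eta> u e = arcosh (cosh_edge_length T \<eta> u e)"

text \<open>
  The first conjunct is needed besides the second because \<open>arcosh\<close> is a total function whose values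
  outside \<open>{1..}\<close> are meaningless.
\<close>

definition discrete_conformal_structure ::
  "'f triangulation \<Rightarrow> ('f red_edge set \<Rightarrow> real) \<Rightarrow> ('f arc set \<Rightarrow> real) \<Rightarrow> bool" where
  "discrete_conformal_structure T \<eta> u \<longleftrightarrow>
     (\<forall>e\<in>edges T. cosh_edge_length T \<eta> u e > 1) \<and>
     discrete_hyperbolic_metric T (conformal_metric T \<eta> u)"

end

theory Submission
  imports Defs
begin

text \<open>
  In the coordinates \<open>s = arctan (exp u)\<close> an edge length satisfies
  \<open>cosh l = tan s\<^sub>i tan s\<^sub>j + \<eta> / (cos s\<^sub>i cos s\<^sub>j)\<close>, so it is admissible iff \<open>cos (s\<^sub>i + s\<^sub>j) < \<eta>\<close>.
  As \<open>0 < s\<^sub>i + s\<^sub>j < \<pi>\<close>, the admissible set is convex.  In each face the Jacobian of the boundary arc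
  lengths with respect to \<open>s\<close> is negative definite.  Integrating along the segment between two
  discrete conformal structures and summing over the faces gives
  \<open>\<Sum>\<^sub>b (K'\<^sub>b - K\<^sub>b) (s'\<^sub>b - s\<^sub>b) < 0\<close> unless \<open>s = s'\<close>; for equal curvatures the sum vanishes.
\<close>

text \<open>The coordinate \<open>s\<close> removes the weight from the derivatives: for
  \<open>c = cosh l\<close> of an edge, the partial derivative in \<open>s\<^sub>i\<close> is
  \<open>tan s\<^sub>j + c * tan s\<^sub>i\<close>, because
  \<open>\<eta> / (cos s\<^sub>i * cos s\<^sub>j)\<close> equals
  \<open>c - tan s\<^sub>i * tan s\<^sub>j\<close>. The quadratic form of a face then involves only
  three numbers \<open>c > 1\<close> and three positive tangents. It is linear in the tangents, so
  each coefficient can be treated as a form in two variables. Convexity is needed because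
  \<open>arcosh\<close> must be differentiated along the whole segment, hence \<open>c > 1\<close>
  must hold on all of it. A separate obstacle is that the curvature refers to a hexagon picked by
  \<open>SOME\<close>. Existence of a hexagon with given red sides makes the choice meaningful, and
  the law of cosines makes the black lengths independent of it.\<close>

section \<open>Side lengths of a right-angled hexagon as functions of three alternate sides\<close>

text \<open>The arguments are the hyperbolic cosines of three pairwise non-adjacent sides; the value is the
  length of the side opposite to the first one and adjacent to the other two.\<close>

definition opposite_side :: "real \<Rightarrow> real \<Rightarrow> real \<Rightarrow> real" where
  "opposite_side x y z = arcosh ((x + y * z) / (sqrt (y\<^sup>2 - 1) * sqrt (z\<^sup>2 - 1)))"

text \<open>The negative of the Gram determinant of the unit normals of the three black sides.\<close>

definition hexagon_gram :: "real \<Rightarrow> real \<Rightarrow> real \<Rightarrow> real" where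
  "hexagon_gram x y z = x\<^sup>2 + y\<^sup>2 + z\<^sup>2 + 2 * x * y * z - 1"

text \<open>The right-hand side is the numerator of \<open>q\<^sup>2 - 1\<close>, where
  \<open>q\<close> is the argument of \<open>arcosh\<close> in \<open>opposite_side x y z\<close>.
  For positive \<open>q\<close>, positivity thus means \<open>q > 1\<close>, where
  \<open>arcosh\<close> is differentiable.\<close>

lemma hexagon_gram_eq:
  "hexagon_gram x y z = (x + y * z)\<^sup>2 - (y\<^sup>2 - 1) * (z\<^sup>2 - 1)"
  by (simp add: hexagon_gram_def power2_eq_square algebra_simps)

lemma hexagon_gram_pos:
  assumes "x > 1" "y > 1" "z > 1"
  shows "hexagon_gram x y z > 0"
proof -
  have "x\<^sup>2 > 1" "2 * x * y * z > 0" "y\<^sup>2 \<ge> 0" "z\<^sup>2 \<ge> 0" using assms by auto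
  then show ?thesis unfolding hexagon_gram_def by linarith
qed

lemma has_real_derivative_opposite_side:
  assumes x: "(x has_real_derivative x') (at t)"
    and y: "(y has_real_derivative y') (at t)"
    and z: "(z has_real_derivative z') (at t)"
    and gt: "x t > 1" "y t > 1" "z t > 1"
  shows "((\<lambda>t. opposite_side (x t) (y t) (z t)) has_real_derivative
      (x' - y' * (z t + x t * y t) / ((y t)\<^sup>2 - 1) - z' * (y t + x t * z t) / ((z t)\<^sup>2 - 1))
        / sqrt (hexagon_gram (x t) (y t) (z t))) (at t)"
proof -
  define Y Z where "Y = sqrt ((y t)\<^sup>2 - 1)" and "Z = sqrt ((z t)\<^sup>2 - 1)"
  define p where "p = x t + y t * z t"
  define D where "D = hexagon_gram (x t) (y t) (z t)"
  have S: "(y t)\<^sup>2 - 1 > 0" "(z t)\<^sup>2 - 1 > 0" using gt by auto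
  have pos: "Y > 0" "Z > 0" "p > 0" using gt S by (auto simp: Y_def Z_def p_def add_pos_pos)
  have Y2: "Y\<^sup>2 = (y t)\<^sup>2 - 1" and Z2: "Z\<^sup>2 = (z t)\<^sup>2 - 1"
    using S by (auto simp: Y_def Z_def)
  have D0: "D > 0" unfolding D_def using gt by (rule hexagon_gram_pos)
  have D: "D = p\<^sup>2 - Y\<^sup>2 * Z\<^sup>2"
    unfolding D_def hexagon_gram_eq p_def Y2 Z2 ..
  have q: "p / (Y * Z) > 1"
  proof -
    have "(Y * Z)\<^sup>2 < p\<^sup>2" using D D0 by (simp add: power_mult_distrib)
    then have "Y * Z < p" using pos by (simp add: power2_less_imp_less)
    then show ?thesis using pos by simp
  qed
  have root: "sqrt ((p / (Y * Z))\<^sup>2 - 1) = sqrt D / (Y * Z)"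
  proof -
    have "(p / (Y * Z))\<^sup>2 - 1 = D / (Y * Z)\<^sup>2"
      unfolding D using pos by (simp add: power_divide power_mult_distrib diff_divide_distrib)
    then show ?thesis using pos by (simp add: real_sqrt_divide)
  qed
  have dY: "((\<lambda>t. sqrt ((y t)\<^sup>2 - 1)) has_real_derivative y t * y' / Y) (at t)"
    using S(1) by (auto intro!: derivative_eq_intros y simp: Y_def divide_simps)
  have dZ: "((\<lambda>t. sqrt ((z t)\<^sup>2 - 1)) has_real_derivative z t * z' / Z) (at t)"
    using S(2) by (auto intro!: derivative_eq_intros z simp: Z_def divide_simps)
  define q' where "q' = ((x' + (y' * z t + z' * y t)) * (Y * Z)
    - p * (y t * y' / Y * Z + z t * z' / Z * Y)) / (Y * Z * (Y * Z))"
  have dq: "((\<lambda>t. (x t + y t * z t) / (sqrt ((y t)\<^sup>2 - 1) * sqrt ((z t)\<^sup>2 - 1)))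
      has_real_derivative q') (at t)"
    using DERIV_divide[OF DERIV_add[OF x DERIV_mult[OF y z]] DERIV_mult[OF dY dZ]] pos
    by (simp add: q'_def p_def flip: Y_def Z_def)
  have "((\<lambda>t. opposite_side (x t) (y t) (z t)) has_real_derivative
      1 / sqrt ((p / (Y * Z))\<^sup>2 - 1) * q') (at t)"
    unfolding opposite_side_def
    using DERIV_chain2[OF arcosh_real_has_field_derivative dq] q
    by (simp add: p_def flip: Y_def Z_def)
  moreover have "1 / sqrt ((p / (Y * Z))\<^sup>2 - 1) * q' =
      (x' - y' * (z t + x t * y t) / Y\<^sup>2 - z' * (y t + x t * z t) / Z\<^sup>2) / sqrt D"
  proof -
    \<comment> \<open>By \<open>root\<close> the chain rule contributes the factor
      \<open>Y * Z / sqrt D\<close>.\<close>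
    have "q' * (Y * Z) = x' + y' * (z t - p * y t / Y\<^sup>2) + z' * (y t - p * z t / Z\<^sup>2)"
    proof -
      have "q' * (Y * Z) = ((x' + (y' * z t + z' * y t)) * (Y * Z)
        - p * (y t * y' / Y * Z + z t * z' / Z * Y)) / (Y * Z)"
        using pos by (simp add: q'_def)
      also have "\<dots> = (x' + (y' * z t + z' * y t)) - p * (y t * y' / Y\<^sup>2 + z t * z' / Z\<^sup>2)"
        using pos by (simp add: diff_divide_distrib distrib_left add_divide_distrib power2_eq_square)
      finally show ?thesis by (simp add: algebra_simps)
    qed
    moreover have "z t - p * y t / Y\<^sup>2 = - ((z t + x t * y t) / Y\<^sup>2)"
    proof -
      have "z t - p * y t / Y\<^sup>2 = (z t * Y\<^sup>2 - p * y t) / Y\<^sup>2"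
        using pos by (simp add: diff_divide_distrib)
      also have "z t * Y\<^sup>2 - p * y t = - (z t + x t * y t)"
        unfolding Y2 p_def by (simp add: algebra_simps power2_eq_square)
      finally show ?thesis by (simp only: minus_divide_left)
    qed
    moreover have "y t - p * z t / Z\<^sup>2 = - ((y t + x t * z t) / Z\<^sup>2)"
    proof -
      have "y t - p * z t / Z\<^sup>2 = (y t * Z\<^sup>2 - p * z t) / Z\<^sup>2"
        using pos by (simp add: diff_divide_distrib)
      also have "y t * Z\<^sup>2 - p * z t = - (y t + x t * z t)"
        unfolding Z2 p_def by (simp add: algebra_simps power2_eq_square)
      finally show ?thesis by (simp only: minus_divide_left)
    qed
    ultimately have "q' * (Y * Z) = x' - y' * (z t + x t * y t) / Y\<^sup>2 - z' * (y t + x t * z t) / Z\<^sup>2"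
      by simp
    then show ?thesis unfolding root by (simp add: mult.commute)
  qed
  ultimately show ?thesis by (simp add: Y2 Z2 D_def)
qed

section \<open>The angle coordinates\<close>

text \<open>The hyperbolic cosine of an edge length in the coordinates \<open>s = arctan (exp u)\<close>.\<close>

definition edge_cosh :: "real \<Rightarrow> real \<Rightarrow> real \<Rightarrow> real" where
  "edge_cosh \<eta> s t = tan s * tan t + \<eta> / (cos s * cos t)"

text \<open>Multiply by \<open>cos s * cos t > 0\<close> and use the addition formula.\<close>

lemma edge_cosh_gt_1_iff:
  assumes "0 < s" "s < pi / 2" "0 < t" "t < pi / 2"
  shows "edge_cosh \<eta> s t > 1 \<longleftrightarrow> cos (s + t) < \<eta>"
proof -
  have "cos s > 0" "cos t > 0" using assms by (auto intro: cos_gt_zero)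
  then show ?thesis by (simp add: edge_cosh_def tan_def cos_add field_simps)
qed

lemma convex_combination_bounds:
  fixes a b r :: real
  assumes "0 \<le> r" "r \<le> 1"
  shows "min a b \<le> a + r * (b - a)" "a + r * (b - a) \<le> max a b"
proof -
  have "a + r * (b - a) = (1 - r) * a + r * b" by (simp add: algebra_simps)
  then show "min a b \<le> a + r * (b - a)" "a + r * (b - a) \<le> max a b"
    using convex_bound_le[of a "max a b" b "1 - r" r] assms
      convex_bound_le[of "-a" "- min a b" "-b" "1 - r" r] by simp_all
qed

text \<open>It suffices that \<open>cos\<close> decreases on the interval from 0 to
  \<open>pi\<close> and that on the segment the sum of the two angles never drops below the smaller
  of its end values.\<close>

lemma edge_cosh_gt_1_convex:
  assumes st: "0 < s" "s < pi / 2" "0 < t" "t < pi / 2"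
    and st': "0 < s'" "s' < pi / 2" "0 < t'" "t' < pi / 2"
    and gt: "edge_cosh \<eta> s t > 1" "edge_cosh \<eta> s' t' > 1"
    and r: "0 \<le> r" "r \<le> 1"
  shows "edge_cosh \<eta> (s + r * (s' - s)) (t + r * (t' - t)) > 1"
proof -
  have s: "0 < s + r * (s' - s)" "s + r * (s' - s) < pi / 2"
    using convex_combination_bounds[OF r, of s s'] st st' by linarith+
  have t: "0 < t + r * (t' - t)" "t + r * (t' - t) < pi / 2"
    using convex_combination_bounds[OF r, of t t'] st st' by linarith+
  have "min (s + t) (s' + t') \<le> s + r * (s' - s) + (t + r * (t' - t))"
    using convex_combination_bounds(1)[OF r, of "s + t" "s' + t'"] by (simp add: algebra_simps)
  then have "cos (s + r * (s' - s) + (t + r * (t' - t))) \<le> cos (min (s + t) (s' + t'))"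
    using st st' s t by (intro cos_monotone_0_pi_le) (auto simp: min_def)
  also have "\<dots> < \<eta>" using st st' gt by (auto simp: edge_cosh_gt_1_iff min_def)
  finally show ?thesis using s t by (simp add: edge_cosh_gt_1_iff)
qed

text \<open>The term with \<open>\<eta>\<close> reproduces itself under differentiation up to
  tangents, so it can be expressed by \<open>c\<close> again and \<open>\<eta>\<close> drops
  out.\<close>

lemma has_real_derivative_edge_cosh:
  fixes \<eta> a b d e :: real
  defines "c \<equiv> \<lambda>r. edge_cosh \<eta> (a + r * d) (b + r * e)"
  assumes "0 < a + r * d" "a + r * d < pi / 2" "0 < b + r * e" "b + r * e < pi / 2"
  shows "(c has_real_derivative
     tan (a + r * d) * (e + c r * d) + tan (b + r * e) * (d + c r * e)) (at r)"
proof -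
  have pos: "cos (a + r * d) > 0" "cos (b + r * e) > 0"
    using assms by (auto intro: cos_gt_zero)
  have dtan: "((\<lambda>r. tan (a + r * d)) has_real_derivative (1 + (tan (a + r * d))\<^sup>2) * d) (at r)"
    if "cos (a + r * d) > 0" for a d
    using that by (auto intro!: derivative_eq_intros simp: tan_sec power_inverse)
  \<comment> \<open>Stated as a multiple of the secant itself, so that \<open>c\<close> can be
    recognised in the result.\<close>
  have dsec: "((\<lambda>r. 1 / cos (a + r * d)) has_real_derivative tan (a + r * d) * (1 / cos (a + r * d)) * d) (at r)"
    if "cos (a + r * d) > 0" for a d
    using that by (auto intro!: derivative_eq_intros simp: tan_def)
  have "c = (\<lambda>r. tan (a + r * d) * tan (b + r * e) + \<eta> * (1 / cos (a + r * d) * (1 / cos (b + r * e))))"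
    by (simp add: c_def edge_cosh_def)
  moreover from this have "c r = tan (a + r * d) * tan (b + r * e) + \<eta> * (1 / cos (a + r * d) * (1 / cos (b + r * e)))"
    by metis
  ultimately show ?thesis
    using DERIV_add[OF DERIV_mult[OF dtan[OF pos(1)] dtan[OF pos(2)]]
        DERIV_cmult[OF DERIV_mult[OF dsec[OF pos(1)] dsec[OF pos(2)]], of \<eta>]]
    by (elim DERIV_cong[rotated] ssubst) (simp add: algebra_simps power2_eq_square)
qed

text \<open>The condition \<open>p\<^sup>2 > S * T\<close> says that the product of the diagonal
  coefficients exceeds 1, the square of the mixed one. The proof completes the square after clearing
  denominators.\<close>

lemma definite_form_pos:
  fixes p S T v w :: real
  assumes "p > 0" "S > 0" "T > 0" "p\<^sup>2 > S * T" "v \<noteq> 0 \<or> w \<noteq> 0"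
  shows "p / S * v\<^sup>2 - 2 * v * w + p / T * w\<^sup>2 > 0"
proof -
  have "p * T * (p * T * v\<^sup>2 - 2 * S * T * v * w + p * S * w\<^sup>2)
    = (p * T * v - S * T * w)\<^sup>2 + S * T * (p\<^sup>2 - S * T) * w\<^sup>2"
    by (simp add: power2_eq_square algebra_simps)
  also have "\<dots> > 0"
  proof (cases "w = 0")
    case True
    then show ?thesis using assms by simp
  next
    case False
    then have "S * T * (p\<^sup>2 - S * T) * w\<^sup>2 > 0" using assms by simp
    then show ?thesis by (simp add: add_nonneg_pos)
  qed
  finally have "p * T * v\<^sup>2 - 2 * S * T * v * w + p * S * w\<^sup>2 > 0"
    by (rule zero_less_mult_pos) (use assms in simp)
  moreover have "p / S * v\<^sup>2 - 2 * v * w + p / T * w\<^sup>2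
     = (p * T * v\<^sup>2 - 2 * S * T * v * w + p * S * w\<^sup>2) / (S * T)"
    using assms by (simp add: field_simps)
  ultimately show ?thesis using assms by simp
qed

text \<open>Up to the positive factor \<open>1 / sqrt (hexagon_gram c0 c1 c2)\<close> this is the quadratic form of the
  Jacobian of the three black side lengths.  Each of the three coefficients of \<open>x0\<close>, \<open>x1\<close>, \<open>x2\<close> is
  semidefinite of rank two, and the three kernels have no common nonzero vector.\<close>

lemma face_form_neg:
  fixes c0 c1 c2 x0 x1 x2 d0 d1 d2 :: real
  assumes c: "c0 > 1" "c1 > 1" "c2 > 1" and x: "x0 > 0" "x1 > 0" "x2 > 0"
    and d: "d0 \<noteq> 0 \<or> d1 \<noteq> 0 \<or> d2 \<noteq> 0"
  defines "c0' \<equiv> x1 * (d2 + c0 * d1) + x2 * (d1 + c0 * d2)"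
    and "c1' \<equiv> x2 * (d0 + c1 * d2) + x0 * (d2 + c1 * d0)"
    and "c2' \<equiv> x0 * (d1 + c2 * d0) + x1 * (d0 + c2 * d1)"
  shows "d0 * (c0' - c1' * (c2 + c0 * c1) / (c1\<^sup>2 - 1) - c2' * (c1 + c0 * c2) / (c2\<^sup>2 - 1))
       + d1 * (c1' - c2' * (c0 + c1 * c2) / (c2\<^sup>2 - 1) - c0' * (c2 + c1 * c0) / (c0\<^sup>2 - 1))
       + d2 * (c2' - c0' * (c1 + c2 * c0) / (c0\<^sup>2 - 1) - c1' * (c0 + c2 * c1) / (c1\<^sup>2 - 1)) < 0"
    (is "?L < 0")
proof -
  define S0 S1 S2 where "S0 = c0\<^sup>2 - 1" and "S1 = c1\<^sup>2 - 1" and "S2 = c2\<^sup>2 - 1"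
  define p0 p1 p2 where "p0 = c0 + c1 * c2" and "p1 = c1 + c2 * c0" and "p2 = c2 + c0 * c1"
  define F :: "real \<Rightarrow> real \<Rightarrow> real \<Rightarrow> real \<Rightarrow> real \<Rightarrow> real"
    where "F p S T v w = p / S * v\<^sup>2 - 2 * v * w + p / T * w\<^sup>2" for p S T v w
  have S: "S0 > 0" "S1 > 0" "S2 > 0" using c by (auto simp: S0_def S1_def S2_def)
  have p: "p0 > 0" "p1 > 0" "p2 > 0" using c by (auto simp: p0_def p1_def p2_def add_pos_pos)
  \<comment> \<open>Rests on \<open>d * (b + c * a) + e * (a + b * c) = (a + b * c) * (e + c * d) -
    b * d * (c\<^sup>2 - 1)\<close>, used for the \<open>x\<close> part, and on its mirror image,
    used for the \<open>y\<close> part. The last term loses the denominator.\<close>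
  have edge: "(x * (e + c * d) + y * (d + c * e)) * (d * (b + c * a) + e * (a + b * c)) / (c\<^sup>2 - 1)
    = x * ((a + b * c) / (c\<^sup>2 - 1) * (e + c * d)\<^sup>2) + y * ((b + c * a) / (c\<^sup>2 - 1) * (d + c * e)\<^sup>2)
      - x * (e + c * d) * d * b - y * (d + c * e) * e * a"
    if "c > 1" for a b c d e x y :: real
  proof -
    have "c\<^sup>2 > 1" using that by simp
    then have S: "c\<^sup>2 - 1 \<noteq> 0" by simp
    have "(x * (e + c * d) + y * (d + c * e)) * (d * (b + c * a) + e * (a + b * c))
      = x * ((a + b * c) * (e + c * d)\<^sup>2) + y * ((b + c * a) * (d + c * e)\<^sup>2)
        - (x * (e + c * d) * d * b + y * (d + c * e) * e * a) * (c\<^sup>2 - 1)"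
      by (simp add: algebra_simps power2_eq_square)
    then have "(x * (e + c * d) + y * (d + c * e)) * (d * (b + c * a) + e * (a + b * c)) / (c\<^sup>2 - 1)
      = x * ((a + b * c) * (e + c * d)\<^sup>2) / (c\<^sup>2 - 1) + y * ((b + c * a) * (d + c * e)\<^sup>2) / (c\<^sup>2 - 1)
        - (x * (e + c * d) * d * b + y * (d + c * e) * e * a)"
      using S by (simp only: add_divide_distrib diff_divide_distrib nonzero_mult_div_cancel_right
        not_False_eq_True)
    then show ?thesis by (simp add: diff_diff_eq)
  qed
  have "?L = d0 * c0' + d1 * c1' + d2 * c2'
      - c0' * (d1 * p2 + d2 * p1) / S0 - c1' * (d2 * p0 + d0 * p2) / S1 - c2' * (d0 * p1 + d1 * p0) / S2"
    by (simp add: p0_def p1_def p2_def S0_def S1_def S2_def algebra_simps add_divide_distrib diff_divide_distrib)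
  \<comment> \<open>From a grouping by edges to one by \<open>x0\<close>, \<open>x1\<close>,
    \<open>x2\<close>; in each group the terms without denominator combine to the mixed term of
    \<open>F\<close>.\<close>
  also have "\<dots> = - (x0 * F p0 S2 S1 (d1 + c2 * d0) (d2 + c1 * d0)
     + x1 * F p1 S0 S2 (d2 + c0 * d1) (d0 + c2 * d1)
     + x2 * F p2 S1 S0 (d0 + c1 * d2) (d1 + c0 * d2))"
    using edge[OF c(1), of x1 d2 d1 x2 c2 c1] edge[OF c(2), of x2 d0 d2 x0 c0 c2]
      edge[OF c(3), of x0 d1 d0 x1 c1 c0]
    unfolding F_def S0_def S1_def S2_def p0_def p1_def p2_def c0'_def c1'_def c2'_def
    by (simp add: algebra_simps)
  finally have ident: "?L = - (x0 * F p0 S2 S1 (d1 + c2 * d0) (d2 + c1 * d0)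
     + x1 * F p1 S0 S2 (d2 + c0 * d1) (d0 + c2 * d1)
     + x2 * F p2 S1 S0 (d0 + c1 * d2) (d1 + c0 * d2))" .
  have F_pos: "F p S T v w \<ge> 0 \<and> (v \<noteq> 0 \<or> w \<noteq> 0 \<longrightarrow> F p S T v w > 0)"
    if "p > 0" "S > 0" "T > 0" "p\<^sup>2 > S * T" for p S T v w
    using definite_form_pos[OF that, of v w] by (cases "v = 0 \<and> w = 0") (auto simp: F_def)
  have gt: "p0\<^sup>2 > S2 * S1" "p1\<^sup>2 > S0 * S2" "p2\<^sup>2 > S1 * S0"
    using hexagon_gram_pos[OF c] hexagon_gram_pos[OF c(2,3,1)] hexagon_gram_pos[OF c(3,1,2)]
    by (simp_all add: hexagon_gram_eq p0_def p1_def p2_def S0_def S1_def S2_def mult.commute)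
  note F0 = F_pos[OF p(1) S(3,2) gt(1), of "d1 + c2 * d0" "d2 + c1 * d0"]
    and F1 = F_pos[OF p(2) S(1,3) gt(2), of "d2 + c0 * d1" "d0 + c2 * d1"]
    and F2 = F_pos[OF p(3) S(2,1) gt(3), of "d0 + c1 * d2" "d1 + c0 * d2"]
  \<comment> \<open>Both arguments of the first form and one of the second already have no common
    zero, so one of these two forms is positive and the third need only be nonnegative.\<close>
  have ne: "d1 + c2 * d0 \<noteq> 0 \<or> d0 + c2 * d1 \<noteq> 0 \<or> d2 + c1 * d0 \<noteq> 0"
  proof (rule ccontr)
    assume "\<not> ?thesis"
    then have e: "d1 = - c2 * d0" "d0 + c2 * d1 = 0" "d2 = - c1 * d0" by auto
    then have "(c2\<^sup>2 - 1) * d0 = 0" by (simp add: power2_eq_square algebra_simps)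
    then have "d0 = 0" using S by (simp add: S2_def)
    then show False using d e by simp
  qed
  have "x0 * F p0 S2 S1 (d1 + c2 * d0) (d2 + c1 * d0)
     + x1 * F p1 S0 S2 (d2 + c0 * d1) (d0 + c2 * d1)
     + x2 * F p2 S1 S0 (d0 + c1 * d2) (d1 + c0 * d2) > 0"
  proof (cases "d0 + c2 * d1 = 0")
    case True
    then have "F p0 S2 S1 (d1 + c2 * d0) (d2 + c1 * d0) > 0" using F0 ne by auto
    then show ?thesis using F1 F2 x by (simp add: add_pos_nonneg)
  next
    case False
    then have "F p1 S0 S2 (d2 + c0 * d1) (d0 + c2 * d1) > 0" using F1 by auto
    then show ?thesis using F0 F2 x by (simp add: add_pos_nonneg add_nonneg_pos)
  qed
  then show ?thesis unfolding ident by simp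
qed

section \<open>Monotonicity of the black sides of a face\<close>

definition face_cosh :: "(3 \<Rightarrow> real) \<Rightarrow> (3 \<Rightarrow> real) \<Rightarrow> 3 \<Rightarrow> real" where
  "face_cosh \<eta> s i = edge_cosh (\<eta> i) (s (i + 1)) (s (i + 2))"

definition face_side :: "(3 \<Rightarrow> real) \<Rightarrow> (3 \<Rightarrow> real) \<Rightarrow> 3 \<Rightarrow> real" where
  "face_side \<eta> s i =
     opposite_side (face_cosh \<eta> s i) (face_cosh \<eta> s (i + 1)) (face_cosh \<eta> s (i + 2))"

text \<open>\<open>exhaust_3\<close> and \<open>sum_3\<close> list the elements as 1, 2, 3, whereas
  the hexagons are labelled 0, 1, 2.\<close>

lemma numeral_mod_3: "(3 :: 3) = 0" "(4 :: 3) = 1" "(5 :: 3) = 2"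
  by simp_all

lemma sum_3_from_0: "(\<Sum>i\<in>UNIV. f (i :: 3)) = f 0 + f 1 + f 2"
  by (simp add: sum_3 numeral_mod_3 ac_simps)

lemma face_side_strict_antimono:
  fixes s s' :: "3 \<Rightarrow> real"
  assumes s: "\<And>i. 0 < s i" "\<And>i. s i < pi / 2" "\<And>i. face_cosh \<eta> s i > 1"
    and s': "\<And>i. 0 < s' i" "\<And>i. s' i < pi / 2" "\<And>i. face_cosh \<eta> s' i > 1"
    and ne: "s \<noteq> s'"
  shows "(\<Sum>i\<in>UNIV. (face_side \<eta> s' i - face_side \<eta> s i) * (s' i - s i)) < 0"
proof -
  define d where "d i = s' i - s i" for i
  define path where "path r i = s i + r * d i" for r i
  \<comment> \<open>Pairing with the fixed direction \<open>d\<close> makes the derivative of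
    \<open>g\<close> the quadratic form of the Jacobian evaluated at \<open>d\<close>.\<close>
  define g where "g r = (\<Sum>i\<in>UNIV. d i * face_side \<eta> (path r) i)" for r
  have "g 1 < g 0"
  proof (rule DERIV_neg_imp_decreasing[where a = 0 and b = 1 and f = g])
    fix r :: real
    assume r: "0 \<le> r" "r \<le> 1"
    have rng: "0 < path r i" "path r i < pi / 2" for i
      using convex_combination_bounds[OF r, of "s i" "s' i"] s(1,2)[of i] s'(1,2)[of i]
      unfolding path_def d_def by linarith+
    have gt: "face_cosh \<eta> (path r) i > 1" for i
      unfolding face_cosh_def path_def d_def
      by (rule edge_cosh_gt_1_convex) (use r s s' in \<open>auto simp: face_cosh_def\<close>)
    define x where "x i = tan (path r i)" for i
    define c where "c i = face_cosh \<eta> (path r) i" for i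
    define c' where "c' i = x (i + 1) * (d (i + 2) + c i * d (i + 1))
      + x (i + 2) * (d (i + 1) + c i * d (i + 2))" for i
    have x: "x i > 0" for i unfolding x_def using rng by (intro tan_gt_zero)
    have c: "c i > 1" for i using gt by (simp add: c_def)
    have dc: "((\<lambda>r. face_cosh \<eta> (path r) i) has_real_derivative c' i) (at r)" for i
      using has_real_derivative_edge_cosh[of "s (i + 1)" r "d (i + 1)" "s (i + 2)" "d (i + 2)" "\<eta> i"]
        rng[of "i + 1"] rng[of "i + 2"]
      by (simp add: c'_def c_def x_def face_cosh_def path_def)
    define D where "D = hexagon_gram (c 0) (c 1) (c 2)"
    \<comment> \<open>By symmetry the three derivatives share the factor \<open>1 / sqrt D\<close>,
      which does not affect the sign.\<close>
    have D: "hexagon_gram (c i) (c (i + 1)) (c (i + 2)) = D" for i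
      using exhaust_3[of i] by (auto simp: D_def hexagon_gram_def numeral_mod_3)
    define a' where "a' i = c' i - c' (i + 1) * (c (i + 2) + c i * c (i + 1)) / ((c (i + 1))\<^sup>2 - 1)
        - c' (i + 2) * (c (i + 1) + c i * c (i + 2)) / ((c (i + 2))\<^sup>2 - 1)" for i
    have da: "((\<lambda>r. face_side \<eta> (path r) i) has_real_derivative a' i / sqrt D) (at r)" for i
      using has_real_derivative_opposite_side[OF dc[of i] dc[of "i + 1"] dc[of "i + 2"] gt gt gt]
      unfolding face_side_def a'_def c_def[symmetric] D .
    have "(g has_real_derivative d 0 * (a' 0 / sqrt D) + d 1 * (a' 1 / sqrt D) + d 2 * (a' 2 / sqrt D)) (at r)"
      unfolding g_def sum_3_from_0 by (intro DERIV_add DERIV_cmult da)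
    moreover have "d 0 * (a' 0 / sqrt D) + d 1 * (a' 1 / sqrt D) + d 2 * (a' 2 / sqrt D) < 0"
    proof -
      have "d 0 \<noteq> 0 \<or> d 1 \<noteq> 0 \<or> d 2 \<noteq> 0"
      proof (rule ccontr)
        assume "\<not> ?thesis"
        then have "d i = 0" for i using exhaust_3[of i] by (auto simp: numeral_mod_3)
        then show False using ne by (auto simp: d_def)
      qed
      from face_form_neg[OF c c c x x x this]
      have "d 0 * a' 0 + d 1 * a' 1 + d 2 * a' 2 < 0"
        by (simp add: a'_def c'_def numeral_mod_3)
      moreover have "D > 0" unfolding D_def by (intro hexagon_gram_pos c)
      ultimately have "(d 0 * a' 0 + d 1 * a' 1 + d 2 * a' 2) / sqrt D < 0"
        by (simp add: divide_neg_pos)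
      then show ?thesis by (simp add: add_divide_distrib)
    qed
    ultimately show "\<exists>y. DERIV g r :> y \<and> y < 0" by (intro exI conjI)
  qed simp
  moreover have "g 1 - g 0 = (\<Sum>i\<in>UNIV. (face_side \<eta> s' i - face_side \<eta> s i) * (s' i - s i))"
  proof -
    have "path 1 = s'" "path 0 = s" by (simp_all add: fun_eq_iff path_def d_def)
    then show ?thesis by (simp add: g_def d_def sum_3_from_0 algebra_simps)
  qed
  ultimately show ?thesis by simp
qed

section \<open>The law of cosines for right-angled hexagons\<close>

lemma lorentz_commute: "lorentz x y = lorentz y x"
  by (simp add: lorentz_def mult.commute)

lemma lorentz_add_left: "lorentz (x + y) z = lorentz x z + lorentz y z"
  by (simp add: lorentz_def algebra_simps)

lemma lorentz_diff_left: "lorentz (x - y) z = lorentz x z - lorentz y z"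
  by (simp add: lorentz_def algebra_simps)

lemma lorentz_scaleR_left: "lorentz (a *\<^sub>R x) y = a * lorentz x y"
  by (simp add: lorentz_def algebra_simps)

lemma lorentz_add_right: "lorentz z (x + y) = lorentz z x + lorentz z y"
  by (simp add: lorentz_def algebra_simps)

lemma lorentz_diff_right: "lorentz z (x - y) = lorentz z x - lorentz z y"
  by (simp add: lorentz_def algebra_simps)

lemma lorentz_scaleR_right: "lorentz y (a *\<^sub>R x) = a * lorentz y x"
  by (simp add: lorentz_def algebra_simps)

lemmas lorentz_bilinear = lorentz_add_left lorentz_diff_left lorentz_scaleR_left
  lorentz_add_right lorentz_diff_right lorentz_scaleR_right

text \<open>For points of the hyperbolic plane this is the hyperbolic theorem of Pythagoras.\<close>

lemma right_angle_iff:
  assumes "x \<in> hyp_plane"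
  shows "right_angle y x z \<longleftrightarrow> lorentz y z = - lorentz x y * lorentz x z"
proof -
  have "lorentz x x = -1" using assms by (simp add: hyp_plane_def)
  then have "lorentz (hyp_direction x y) (hyp_direction x z) = lorentz y z + lorentz x y * lorentz x z"
    by (simp add: hyp_direction_def lorentz_bilinear lorentz_commute[of y x])
  then show ?thesis by (simp add: right_angle_def eq_neg_iff_add_eq_0)
qed

text \<open>The reversed Cauchy-Schwarz inequality, from Lagrange's identity for
  \<open>(1, x$1, x$2)\<close> and \<open>(1, y$1, y$2)\<close>.\<close>

lemma lorentz_le_neg_1:
  assumes "x \<in> hyp_plane" "y \<in> hyp_plane"
  shows "lorentz x y \<le> -1"
proof -
  have x: "(x$3)\<^sup>2 = 1 + (x$1)\<^sup>2 + (x$2)\<^sup>2" "x$3 > 0"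
    and y: "(y$3)\<^sup>2 = 1 + (y$1)\<^sup>2 + (y$2)\<^sup>2" "y$3 > 0"
    using assms by (auto simp: hyp_plane_def lorentz_def power2_eq_square)
  have "(x$3 * y$3)\<^sup>2 = (1 + (x$1)\<^sup>2 + (x$2)\<^sup>2) * (1 + (y$1)\<^sup>2 + (y$2)\<^sup>2)"
    by (simp add: power_mult_distrib x y)
  also have "\<dots> = (1 + x$1 * y$1 + x$2 * y$2)\<^sup>2 + (x$1 - y$1)\<^sup>2 + (x$2 - y$2)\<^sup>2
      + (x$1 * y$2 - x$2 * y$1)\<^sup>2"
    by (simp add: power2_eq_square algebra_simps)
  also have "\<dots> \<ge> (1 + x$1 * y$1 + x$2 * y$2)\<^sup>2" by simp
  finally have "\<bar>1 + x$1 * y$1 + x$2 * y$2\<bar> \<le> \<bar>x$3 * y$3\<bar>" by (simp add: abs_le_square_iff)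
  then show ?thesis using x y by (simp add: lorentz_def)
qed

lemma cosh_hyp_dist:
  assumes "x \<in> hyp_plane" "y \<in> hyp_plane"
  shows "cosh (hyp_dist x y) = - lorentz x y"
  using lorentz_le_neg_1[OF assms] by (simp add: hyp_dist_def)

text \<open>The form is positive definite on the complement of a timelike vector; by Cauchy-Schwarz
  in the first two coordinates. It serves to prove vectors equal by showing that their difference is
  null.\<close>

lemma orthogonal_to_hyp_plane_spacelike:
  assumes p: "p \<in> hyp_plane" and z: "lorentz z p = 0" "lorentz z z \<le> 0"
  shows "z = 0"
proof -
  have p3: "(p$3)\<^sup>2 = 1 + ((p$1)\<^sup>2 + (p$2)\<^sup>2)" using p by (auto simp: hyp_plane_def lorentz_def power2_eq_square)
  have le: "(z$1)\<^sup>2 + (z$2)\<^sup>2 \<le> (z$3)\<^sup>2" using z by (simp add: lorentz_def power2_eq_square)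
  have "z$3 * p$3 = z$1 * p$1 + z$2 * p$2" using z by (simp add: lorentz_def)
  then have "(z$3)\<^sup>2 * (p$3)\<^sup>2 = (z$1 * p$1 + z$2 * p$2)\<^sup>2"
    by (metis power_mult_distrib)
  also have "\<dots> = ((z$1)\<^sup>2 + (z$2)\<^sup>2) * ((p$1)\<^sup>2 + (p$2)\<^sup>2) - (z$1 * p$2 - z$2 * p$1)\<^sup>2"
    by (simp add: power2_eq_square algebra_simps)
  also have "\<dots> \<le> (z$3)\<^sup>2 * ((p$1)\<^sup>2 + (p$2)\<^sup>2)"
    using mult_right_mono[OF le sum_power2_ge_zero[of "p$1" "p$2"]]
      zero_le_power2[of "z$1 * p$2 - z$2 * p$1"] by linarith
  finally have "(z$3)\<^sup>2 \<le> 0" by (simp add: p3 algebra_simps)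
  then have "z$3 = 0" by simp
  moreover from this have "z$1 = 0" "z$2 = 0"
    using le by (simp_all add: sum_power2_le_zero_iff)
  ultimately show ?thesis by (simp add: vec_eq_iff forall_3)
qed

text \<open>Multiplicativity of determinants for a Gram matrix; the minus sign is the determinant of
  the Lorentz form.\<close>

lemma det_mult_det_lorentz:
  "det (vector [x, y, z] :: real^3^3) * det (vector [x, y, w] :: real^3^3) =
   - (lorentz x x * (lorentz y y * lorentz z w - lorentz y w * lorentz z y)
    - lorentz x y * (lorentz y x * lorentz z w - lorentz y w * lorentz z x)
    + lorentz x w * (lorentz y x * lorentz z y - lorentz y y * lorentz z x))"
  unfolding det_3 lorentz_def vector_3 by algebra

text \<open>Vectors normal to the line through \<open>p\<close> and \<open>q\<close> are
  proportional, so two unit ones have product 1 or -1, and the side decides which.\<close>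

lemma same_side_normals_eq:
  assumes p: "p \<in> hyp_plane" "q \<in> hyp_plane"
    and X: "lorentz X p = 0" "lorentz X q = 0" "lorentz X X = 1"
    and Y: "lorentz Y p = 0" "lorentz Y q = 0" "lorentz Y Y = 1"
    and side: "same_side p q X Y"
  shows "X = Y"
proof -
  \<comment> \<open>The squared hyperbolic sine of the distance of \<open>p\<close> and
    \<open>q\<close>.\<close>
  define e where "e = (lorentz p q)\<^sup>2 - 1"
  have pq: "lorentz p p = -1" "lorentz q q = -1" using p by (auto simp: hyp_plane_def)
  have det: "det (vector [p, q, Z] :: real^3^3) * det (vector [p, q, W] :: real^3^3) = e * lorentz Z W"
    if "lorentz Z p = 0" "lorentz Z q = 0" "lorentz W p = 0" "lorentz W q = 0" for Z W
    using that pq unfolding det_mult_det_lorentz e_def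
    by (simp add: lorentz_commute[of p W] lorentz_commute[of q W] lorentz_commute[of q p] power2_eq_square algebra_simps)
  define a b where "a = det (vector [p, q, X] :: real^3^3)" and "b = det (vector [p, q, Y] :: real^3^3)"
  have ab: "a * b = e * lorentz X Y" "a * a = e" "b * b = e"
    using det[of X Y] det[of X X] det[of Y Y] X Y by (simp_all add: a_def b_def)
  have pos: "e * lorentz X Y > 0" using side ab(1) by (simp add: same_side_def a_def b_def)
  have "(e * lorentz X Y)\<^sup>2 = (a * a) * (b * b)"
    unfolding ab(1)[symmetric] by (simp add: power2_eq_square)
  also have "\<dots> = e\<^sup>2" by (simp add: ab power2_eq_square)
  finally have "e\<^sup>2 * (lorentz X Y)\<^sup>2 = e\<^sup>2" by (simp add: power_mult_distrib)
  moreover have "e \<noteq> 0" using pos by auto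
  ultimately have "(lorentz X Y)\<^sup>2 = 1" by simp
  moreover have "e \<ge> 0"
    using lorentz_le_neg_1[OF p] abs_le_square_iff[of 1 "lorentz p q"] by (simp add: e_def)
  then have "lorentz X Y > 0" using pos by (simp add: zero_less_mult_iff)
  ultimately have "lorentz X Y = 1" by (simp add: power2_eq_1_iff)
  then have "lorentz (X - Y) (X - Y) = 0" using X Y by (simp add: lorentz_bilinear lorentz_commute[of Y X])
  moreover have "lorentz (X - Y) p = 0" using X Y by (simp add: lorentz_bilinear)
  ultimately have "X - Y = 0" using orthogonal_to_hyp_plane_spacelike[OF p(1), of "X - Y"] by simp
  then show ?thesis by simp
qed

lemma lorentz_less_neg_1:
  assumes "x \<in> hyp_plane" "y \<in> hyp_plane" "x \<noteq> y"
  shows "lorentz x y < -1"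
proof (rule ccontr)
  assume "\<not> lorentz x y < -1"
  then have xy: "lorentz x y = -1" using lorentz_le_neg_1[OF assms(1,2)] by simp
  have "lorentz x x = -1" "lorentz y y = -1" using assms by (auto simp: hyp_plane_def)
  with xy have "lorentz (x - y) x = 0" "lorentz (x - y) (x - y) \<le> 0"
    by (simp_all add: lorentz_bilinear lorentz_commute[of y x])
  then have "x - y = 0" by (rule orthogonal_to_hyp_plane_spacelike[OF assms(1)])
  then show False using assms by simp
qed

section \<open>Unit normals of the sides\<close>

definition unit_direction :: "real^3 \<Rightarrow> real^3 \<Rightarrow> real^3" where
  "unit_direction x y = (1 / sqrt ((lorentz x y)\<^sup>2 - 1)) *\<^sub>R hyp_direction x y"

text \<open>A right angle at \<open>x\<close> turns the direction along one side into a unit normal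
  of the line carrying the other side.\<close>

lemma unit_direction_props:
  assumes "x \<in> hyp_plane" "y \<in> hyp_plane" "x \<noteq> y"
  shows "(lorentz x y)\<^sup>2 > 1"
    and "lorentz (unit_direction x y) x = 0"
    and "lorentz (unit_direction x y) (unit_direction x y) = 1"
    and "right_angle y x z \<Longrightarrow> lorentz (unit_direction x y) z = 0"
    and "right_angle z x y \<Longrightarrow> lorentz (unit_direction x y) z = 0"
proof -
  have xy: "lorentz x x = -1" "lorentz y y = -1" using assms by (auto simp: hyp_plane_def)
  have "1 < \<bar>lorentz x y\<bar>" using lorentz_less_neg_1[OF assms] by simp
  then show gt: "(lorentz x y)\<^sup>2 > 1" using abs_square_less_1[of "lorentz x y"] abs_square_eq_1[of "lorentz x y"]
    by linarith
  show "lorentz (unit_direction x y) x = 0"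
    by (simp add: unit_direction_def hyp_direction_def lorentz_bilinear xy lorentz_commute[of y x])
  have "lorentz (hyp_direction x y) (hyp_direction x y) = (lorentz x y)\<^sup>2 - 1"
    by (simp add: hyp_direction_def lorentz_bilinear xy lorentz_commute[of y x] power2_eq_square)
  then show "lorentz (unit_direction x y) (unit_direction x y) = 1"
    using gt by (simp add: unit_direction_def lorentz_bilinear)
  show *: "right_angle y x z \<Longrightarrow> lorentz (unit_direction x y) z = 0"
    by (simp add: right_angle_iff[OF assms(1)] unit_direction_def hyp_direction_def lorentz_bilinear)
  show "right_angle z x y \<Longrightarrow> lorentz (unit_direction x y) z = 0"
    by (rule *) (simp add: right_angle_def lorentz_commute)
qed

text \<open>The direction differs from \<open>z\<close> by a multiple of another row, so only the
  scaling survives, and directions can replace vertices in tests of sides.\<close>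

lemma det_unit_direction:
  "det (vector [x, y, unit_direction x z] :: real^3^3)
     = det (vector [x, y, z] :: real^3^3) / sqrt ((lorentz x z)\<^sup>2 - 1)"
  "det (vector [x, y, unit_direction y z] :: real^3^3)
     = det (vector [x, y, z] :: real^3^3) / sqrt ((lorentz y z)\<^sup>2 - 1)"
  unfolding det_3 unit_direction_def hyp_direction_def vector_3
  by (simp_all add: algebra_simps add_divide_distrib diff_divide_distrib)

text \<open>Two consecutive right angles make both directions normal to the line through \<open>b\<close> and \<open>c\<close>;
  convexity excludes that they are opposite.\<close>

lemma unit_directions_eq:
  assumes hyp: "a \<in> hyp_plane" "b \<in> hyp_plane" "c \<in> hyp_plane" "d \<in> hyp_plane"
    and right: "right_angle a b c" "right_angle b c d"
    and ne: "b \<noteq> a" "c \<noteq> d"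
    and side: "same_side b c a d"
  shows "unit_direction b a = unit_direction c d"
proof (rule same_side_normals_eq[OF hyp(2,3)])
  note X = unit_direction_props[OF hyp(2,1) ne(1)] and Y = unit_direction_props[OF hyp(3,4) ne(2)]
  show "lorentz (unit_direction b a) b = 0" "lorentz (unit_direction b a) c = 0"
    "lorentz (unit_direction b a) (unit_direction b a) = 1"
    using X right by auto
  show "lorentz (unit_direction c d) b = 0" "lorentz (unit_direction c d) c = 0"
    "lorentz (unit_direction c d) (unit_direction c d) = 1"
    using Y right by auto
  have "0 < sqrt ((lorentz b a)\<^sup>2 - 1) * sqrt ((lorentz c d)\<^sup>2 - 1)"
    using X(1) Y(1) by simp
  then show "same_side b c (unit_direction b a) (unit_direction c d)"
    using side unfolding same_side_def det_unit_direction times_divide_times_eq by (rule divide_pos_pos[rotated])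
qed

text \<open>Coinciding end points would make the determinant in \<open>same_side\<close>
  vanish.\<close>

lemma right_angled_hexagon_vertices_distinct:
  assumes "right_angled_hexagon p"
  shows "p k \<noteq> p (k + 1)"
proof
  assume eq: "p k = p (k + 1)"
  have "k + 2 \<notin> {k, k + 1}" by auto
  then have "same_side (p k) (p (k + 1)) (p (k + 2)) (p (k + 2))"
    using assms unfolding right_angled_hexagon_def by blast
  then show False unfolding same_side_def eq[symmetric] by (simp add: det_3)
qed

lemma numeral_mod_6: "(- 1 :: 6) = 5" "(6 :: 6) = 0" "(7 :: 6) = 1" "(8 :: 6) = 2" "(9 :: 6) = 3" "(10 :: 6) = 4" "(11 :: 6) = 5"
  by simp_all

text \<open>Every side has one unit normal that is visible as a direction at both of its ends.
  Comparing the two descriptions for three alternate sides eliminates the diagonals.\<close>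

lemma hexagon_cosine_law:
  assumes "right_angled_hexagon p"
  shows "hyp_dist (p k) (p (k + 1)) =
    opposite_side (- lorentz (p (k + 3)) (p (k + 4))) (- lorentz (p (k + 5)) (p k))
      (- lorentz (p (k + 1)) (p (k + 2)))"
proof -
  define P where "P j = p (k + j)" for j
  have hyp: "P j \<in> hyp_plane" for j
    using assms by (simp add: right_angled_hexagon_def P_def)
  then have self: "lorentz (P j) (P j) = -1" for j by (simp add: hyp_plane_def)
  have right: "right_angle (P (j - 1)) (P j) (P (j + 1))" for j
  proof -
    have "right_angle (p (k + j - 1)) (p (k + j)) (p (k + j + 1))"
      using assms unfolding right_angled_hexagon_def by blast
    then show ?thesis by (simp add: P_def algebra_simps)
  qed
  have ne: "P j \<noteq> P (j + 1)" for j
    using right_angled_hexagon_vertices_distinct[OF assms, of "k + j"] by (simp add: P_def add.assoc)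
  have side: "same_side (P j) (P (j + 1)) (P m) (P n)" if "m \<notin> {j, j + 1}" "n \<notin> {j, j + 1}" for j m n
  proof -
    have "k + m \<notin> {k + j, k + j + 1}" "k + n \<notin> {k + j, k + j + 1}" using that by (auto simp: add.assoc)
    then have "same_side (p (k + j)) (p (k + j + 1)) (p (k + m)) (p (k + n))"
      using assms unfolding right_angled_hexagon_def by blast
    then show ?thesis by (simp add: P_def add.assoc)
  qed
  have normals: "unit_direction (P j) (P (j - 1)) = unit_direction (P (j + 1)) (P (j + 2))" for j
  proof (rule unit_directions_eq)
    show "right_angle (P (j - 1)) (P j) (P (j + 1))" by (rule right)
    show "right_angle (P j) (P (j + 1)) (P (j + 2))" using right[of "j + 1"] by (simp add: add.assoc)
    show "P j \<noteq> P (j - 1)" using ne[of "j - 1"] by simp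
    show "P (j + 1) \<noteq> P (j + 2)" using ne[of "j + 1"] by (simp add: add.assoc)
    show "same_side (P j) (P (j + 1)) (P (j - 1)) (P (j + 2))"
      by (rule side) (auto simp: algebra_simps)
  qed (rule hyp)+
  \<comment> \<open>\<open>l j\<close> is minus the hyperbolic cosine of a side length, and
    \<open>s j\<close> below is its hyperbolic sine.\<close>
  define l where "l j = lorentz (P j) (P (j + 1))" for j
  define s where "s j = sqrt ((l j)\<^sup>2 - 1)" for j
  have l: "(l j)\<^sup>2 > 1" for j
    unfolding l_def using hyp hyp ne by (rule unit_direction_props(1))
  have s: "s j > 0" "(s j)\<^sup>2 = (l j)\<^sup>2 - 1" for j
    using l[of j] by (simp_all add: s_def)
  have diag: "lorentz (P j) (P (j + 2)) = - l j * l (j + 1)" for j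
    using right[of "j + 1"] by (simp add: right_angle_iff[OF hyp] l_def lorentz_commute add.assoc)
  have dir: "unit_direction (P j) (P (j + 1)) = (1 / s j) *\<^sub>R (P (j + 1) + l j *\<^sub>R P j)"
    "unit_direction (P (j + 1)) (P j) = (1 / s j) *\<^sub>R (P j + l j *\<^sub>R P (j + 1))" for j
    by (simp_all add: unit_direction_def hyp_direction_def s_def l_def lorentz_commute)
  note [simp] = numeral_mod_6
  have N0: "unit_direction (P 0) (P 5) = unit_direction (P 1) (P 2)"
    and N1: "unit_direction (P 2) (P 1) = unit_direction (P 3) (P 4)"
    and N2: "unit_direction (P 4) (P 3) = unit_direction (P 5) (P 0)"
    using normals[of 0] normals[of 2] normals[of 4] by simp_all
  have d05: "unit_direction (P 0) (P 5) = (1 / (s 5)) *\<^sub>R (P 5 + l 5 *\<^sub>R P 0)"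
    and d50: "unit_direction (P 5) (P 0) = (1 / (s 5)) *\<^sub>R (P 0 + l 5 *\<^sub>R P 5)"
    and d12: "unit_direction (P 1) (P 2) = (1 / (s 1)) *\<^sub>R (P 2 + l 1 *\<^sub>R P 1)"
    and d21: "unit_direction (P 2) (P 1) = (1 / (s 1)) *\<^sub>R (P 1 + l 1 *\<^sub>R P 2)"
    and d34: "unit_direction (P 3) (P 4) = (1 / (s 3)) *\<^sub>R (P 4 + l 3 *\<^sub>R P 3)"
    and d43: "unit_direction (P 4) (P 3) = (1 / (s 3)) *\<^sub>R (P 3 + l 3 *\<^sub>R P 4)"
    using dir[of 5] dir[of 1] dir[of 3] by simp_all
  have flat: "lorentz (P 0) (P 1) = l 0" "lorentz (P 1) (P 0) = l 0"
    "lorentz (P 3) (P 4) = l 3" "lorentz (P 4) (P 3) = l 3"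
    "lorentz (P 5) (P 1) = - l 5 * l 0" "lorentz (P 1) (P 5) = - l 5 * l 0"
    "lorentz (P 2) (P 0) = - l 0 * l 1" "lorentz (P 0) (P 2) = - l 0 * l 1"
    using diag[of 5] diag[of 0] by (simp_all add: l_def lorentz_commute)
  \<comment> \<open>The long diagonal from \<open>P 2\<close> to \<open>P 5\<close> is not reached
    by \<open>diag\<close>; it is found from the common normal of \<open>P 0 P 1\<close> having norm
    1.\<close>
  have "lorentz (unit_direction (P 0) (P 5)) (unit_direction (P 1) (P 2)) = 1"
    unfolding N0[symmetric] using ne[of 5] by (intro unit_direction_props(3) hyp) simp
  moreover have "lorentz (unit_direction (P 0) (P 5)) (unit_direction (P 1) (P 2)) =
    (lorentz (P 2) (P 5) - l 0 * l 1 * l 5) / (s 1 * s 5)"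
    unfolding d05 d12 by (simp add: lorentz_bilinear flat lorentz_commute[of "P 5" "P 2"] algebra_simps
      add_divide_distrib diff_divide_distrib)
  ultimately have P25: "lorentz (P 2) (P 5) = s 1 * s 5 + l 0 * l 1 * l 5"
    using s(1)[of 1] s(1)[of 5] by (simp add: field_simps)
  \<comment> \<open>The product of the normals of the sides \<open>P 2 P 3\<close> and \<open>P 4 P 5\<close>, computed at both of their neighbours.\<close>
  have "l 3 = lorentz (unit_direction (P 3) (P 4)) (unit_direction (P 4) (P 3))"
  proof -
    have "lorentz (unit_direction (P 3) (P 4)) (unit_direction (P 4) (P 3)) = l 3 * ((l 3)\<^sup>2 - 1) / (s 3)\<^sup>2"
      unfolding d34 d43 by (simp add: lorentz_bilinear flat self power2_eq_square algebra_simps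
        add_divide_distrib diff_divide_distrib)
    then show ?thesis using l[of 3] by (simp add: s(2))
  qed
  also have "\<dots> = lorentz (unit_direction (P 2) (P 1)) (unit_direction (P 5) (P 0))"
    by (simp only: N1 N2)
  also have "\<dots> = (l 0 * (1 - (l 1)\<^sup>2 - (l 5)\<^sup>2) + l 1 * l 5 * lorentz (P 2) (P 5)) / (s 1 * s 5)"
    unfolding d21 d50 by (simp add: lorentz_bilinear flat power2_eq_square algebra_simps
      add_divide_distrib diff_divide_distrib)
  also have "\<dots> = (l 0 * (s 1)\<^sup>2 * (s 5)\<^sup>2 + l 1 * l 5 * (s 1 * s 5)) / (s 1 * s 5)"
    unfolding P25 s(2) by (simp add: power2_eq_square algebra_simps)
  also have "\<dots> = l 0 * s 1 * s 5 + l 1 * l 5"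
    using s(1)[of 1] s(1)[of 5] by (simp add: field_simps power2_eq_square)
  finally have "- l 0 = (- l 3 + (- l 5) * (- l 1)) / (s 5 * s 1)"
    using s(1)[of 1] s(1)[of 5] by (simp add: field_simps)
  then show ?thesis
    unfolding hyp_dist_def opposite_side_def by (simp add: l_def s_def P_def)
qed

section \<open>Existence of right-angled hexagons\<close>

lemma right_angle_commute: "right_angle y x z \<longleftrightarrow> right_angle z x y"
  by (simp add: right_angle_def lorentz_commute)

text \<open>By the Gram identity both determinants are the same nonzero multiple of the products
  with \<open>n\<close>.\<close>

lemma same_side_if_normal:
  assumes hyp: "x \<in> hyp_plane" "y \<in> hyp_plane" and ne: "x \<noteq> y"
    and n: "lorentz n x = 0" "lorentz n y = 0" "lorentz n n > 0"
    and side: "lorentz n v > 0" "lorentz n w > 0"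
  shows "same_side x y v w"
proof -
  define e where "e = (lorentz x y)\<^sup>2 - 1"
  have e: "e > 0" unfolding e_def using unit_direction_props(1)[OF hyp ne] by simp
  have xy: "lorentz x x = -1" "lorentz y y = -1" using hyp by (auto simp: hyp_plane_def)
  define N where "N = det (vector [x, y, n] :: real^3^3)"
  have det: "N * det (vector [x, y, v] :: real^3^3) = e * lorentz n v" for v
    unfolding N_def det_mult_det_lorentz e_def using n xy
    by (simp add: lorentz_commute[of y x] power2_eq_square algebra_simps)
  have "(N * N) * (det (vector [x, y, v] :: real^3^3) * det (vector [x, y, w] :: real^3^3))
      = (e * lorentz n v) * (e * lorentz n w)"
    unfolding det[symmetric] by simp
  also have "\<dots> > 0" using e side by simp
  finally have "(N * N) * (det (vector [x, y, v] :: real^3^3) * det (vector [x, y, w] :: real^3^3)) > 0" .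
  moreover have "N * N > 0" using det[of n] e n by (simp add: N_def)
  ultimately show ?thesis unfolding same_side_def by (rule zero_less_mult_pos)
qed

text \<open>Inner normals certify convexity by linear inequalities instead of products of
  determinants.\<close>

lemma right_angled_hexagonI:
  assumes hyp: "\<And>k. p k \<in> hyp_plane"
    and right: "\<And>k. right_angle (p (k - 1)) (p k) (p (k + 1))"
    and n: "\<And>k. lorentz (n k) (p k) = 0" "\<And>k. lorentz (n k) (p (k + 1)) = 0" "\<And>k. lorentz (n k) (n k) > 0"
    and side: "\<And>k m. m \<notin> {k, k + 1} \<Longrightarrow> lorentz (n k) (p m) > 0"
  shows "right_angled_hexagon p"
  unfolding right_angled_hexagon_def
proof (intro conjI allI impI)
  fix k m m' :: 6
  assume m: "m \<notin> {k, k + 1} \<and> m' \<notin> {k, k + 1}"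
  \<comment> \<open>Distinctness of neighbours: \<open>p (k + 1)\<close> lies on side
    \<open>k + 1\<close>, while \<open>p k\<close> is strictly inside it.\<close>
  have "k \<notin> {k + 1, k + 1 + 1}" by (auto simp: add.assoc)
  then have "lorentz (n (k + 1)) (p k) > 0" by (rule side)
  then have "p k \<noteq> p (k + 1)" using n(1)[of "k + 1"] by auto
  then show "same_side (p k) (p (k + 1)) (p m) (p m')"
    using n m side by (intro same_side_if_normal[where n = "n k"] hyp) auto
qed (use hyp right in auto)

text \<open>For unit normals \<open>v\<close>, \<open>w\<close> of two ultraparallel lines with \<open>lorentz v w = - c\<close>, this is the end
  point, on the line of \<open>v\<close>, of their common perpendicular.\<close>

definition foot :: "real \<Rightarrow> real^3 \<Rightarrow> real^3 \<Rightarrow> real^3" where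
  "foot c v w = (1 / sqrt (c\<^sup>2 - 1)) *\<^sub>R (w + c *\<^sub>R v)"

text \<open>The third product is minus the argument of \<open>arcosh\<close> in
  \<open>opposite_side x y z\<close>.\<close>

lemma foot_products:
  assumes unit: "lorentz a a = 1" "lorentz b b = 1"
    and ab: "lorentz a b = - z" and ad: "lorentz a d = - y" and bd: "lorentz b d = - x"
    and z: "z > 1"
  shows "lorentz (foot z a b) (foot z a b) = -1"
    and "lorentz (foot z a b) (foot z b a) = - z"
    and "lorentz (foot y a d) (foot z a b) = - (x + y * z) / (sqrt (y\<^sup>2 - 1) * sqrt (z\<^sup>2 - 1))"
    and "lorentz (foot y a d) (foot z b a) = - z * (x + y * z) / (sqrt (y\<^sup>2 - 1) * sqrt (z\<^sup>2 - 1))"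
    and "lorentz a (foot z a b) = 0"
    and "lorentz a (foot z b a) = - sqrt (z\<^sup>2 - 1)"
    and "lorentz d (foot z a b) = - (x + y * z) / sqrt (z\<^sup>2 - 1)"
proof -
  note products = unit ab ad bd lorentz_commute[of b a] lorentz_commute[of d a] lorentz_commute[of d b]
  define s t where "s = sqrt (z\<^sup>2 - 1)" and "t = sqrt (y\<^sup>2 - 1)"
  have "z\<^sup>2 > 1" using z by simp
  then have s: "s > 0" "s\<^sup>2 = z\<^sup>2 - 1" by (simp_all add: s_def)
  have foot: "foot z a b = (1 / s) *\<^sub>R (b + z *\<^sub>R a)" "foot z b a = (1 / s) *\<^sub>R (a + z *\<^sub>R b)"
    "foot y a d = (1 / t) *\<^sub>R (d + y *\<^sub>R a)"
    by (simp_all add: foot_def s_def t_def)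
  note expand = foot lorentz_bilinear products power2_eq_square algebra_simps
    add_divide_distrib diff_divide_distrib
  have z2: "1 - z\<^sup>2 = - (s\<^sup>2)" by (simp add: s)
  have "lorentz (foot z a b) (foot z a b) = (1 - z\<^sup>2) / s\<^sup>2" by (simp add: expand)
  then show "lorentz (foot z a b) (foot z a b) = -1" unfolding z2 using s(1) by simp
  have "lorentz (foot z a b) (foot z b a) = z * (1 - z\<^sup>2) / s\<^sup>2" by (simp add: expand)
  then show "lorentz (foot z a b) (foot z b a) = - z" unfolding z2 using s(1) by simp
  show "lorentz (foot y a d) (foot z a b) = - (x + y * z) / (sqrt (y\<^sup>2 - 1) * sqrt (z\<^sup>2 - 1))"
    "lorentz (foot y a d) (foot z b a) = - z * (x + y * z) / (sqrt (y\<^sup>2 - 1) * sqrt (z\<^sup>2 - 1))"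
    unfolding s_def[symmetric] t_def[symmetric] by (simp_all add: expand)
  show "lorentz a (foot z a b) = 0" by (simp add: expand)
  have "lorentz a (foot z b a) = (1 - z\<^sup>2) / s" by (simp add: expand)
  also have "\<dots> = - s" unfolding z2 using s(1) by (simp add: power2_eq_square)
  finally show "lorentz a (foot z b a) = - sqrt (z\<^sup>2 - 1)" by (simp add: s_def)
  show "lorentz d (foot z a b) = - (x + y * z) / sqrt (z\<^sup>2 - 1)"
    unfolding s_def[symmetric] by (simp add: expand)
qed

text \<open>By \<open>right_angle_iff\<close> it is enough that the fourth product in
  \<open>foot_products\<close> is \<open>z\<close> times the third.\<close>

lemma right_angle_foot:
  assumes "lorentz a a = 1" "lorentz b b = 1"
    and "lorentz a b = - z" "lorentz a d = - y" "lorentz b d = - x" and "z > 1"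
    and "foot z a b \<in> hyp_plane"
  shows "right_angle (foot y a d) (foot z a b) (foot z b a)"
  unfolding right_angle_iff[OF assms(7)] lorentz_commute[of "foot z a b" "foot y a d"]
    foot_products(2-4)[OF assms(1-6)]
  by (simp add: algebra_simps add_divide_distrib diff_divide_distrib)

text \<open>With \<open>v0\<close> an axis and \<open>v1\<close> in a coordinate plane, the products
  fix two coordinates of \<open>v2\<close>, and norm 1 requires the square of the remaining one to
  be \<open>D / s\<^sup>2\<close>, which is positive.\<close>

lemma exists_normals_with_products:
  fixes c0 c1 c2 :: real
  assumes c: "c0 > 1" "c1 > 1" "c2 > 1"
  obtains v0 v1 v2 :: "real^3" where
    "lorentz v0 v0 = 1" "lorentz v1 v1 = 1" "lorentz v2 v2 = 1"
    "lorentz v0 v1 = - c2" "lorentz v0 v2 = - c1" "lorentz v1 v2 = - c0"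
    "v0$3 = 0" "v1$3 > 0" "v2$3 > 0"
proof -
  define D s where "D = hexagon_gram c0 c1 c2" and "s = sqrt (c2\<^sup>2 - 1)"
  define p where "p = c0 + c1 * c2"
  have "c2\<^sup>2 > 1" using c by simp
  then have s: "s > 0" "s\<^sup>2 = c2\<^sup>2 - 1" by (simp_all add: s_def)
  have D: "D > 0" "D = p\<^sup>2 - (c1\<^sup>2 - 1) * s\<^sup>2"
    using hexagon_gram_pos[OF c] by (simp_all add: D_def hexagon_gram_eq p_def s(2))
  have p: "p > 0" using c by (simp add: p_def add_pos_pos)
  define v0 v1 v2 :: "real^3" where "v0 = vector [1, 0, 0]" and "v1 = vector [- c2, 0, s]"
    and "v2 = vector [- c1, sqrt D / s, p / s]"
  show thesis
  proof (rule that[of v0 v1 v2])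
    show "lorentz v2 v2 = 1"
    proof -
      have "lorentz v2 v2 = c1\<^sup>2 + (D - p\<^sup>2) / s\<^sup>2"
        using D(1) by (simp add: lorentz_def v2_def power2_eq_square diff_divide_distrib)
      also have "\<dots> = 1" using s(1) by (simp add: D(2))
      finally show ?thesis .
    qed
  qed (use s p in \<open>simp_all add: lorentz_def v0_def v1_def v2_def p_def power2_eq_square\<close>)
qed

lemma six_cases: "k = 0 \<or> k = 1 \<or> k = 2 \<or> k = 3 \<or> k = 4 \<or> k = 5" for k :: 6
proof (induction k)
  case (of_int z)
  then have "0 \<le> z" "z < 6" by simp_all
  then have "z = 0 \<or> z = 1 \<or> z = 2 \<or> z = 3 \<or> z = 4 \<or> z = 5" by arith
  then show ?case by auto
qed

lemma forall_6: "(\<forall>k :: 6. P k) \<longleftrightarrow> P 0 \<and> P 1 \<and> P 2 \<and> P 3 \<and> P 4 \<and> P 5"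
  by (metis six_cases)

text \<open>The \<open>v\<close> are outward unit normals of the black sides; the red sides are
  their common perpendiculars, with the feet as vertices.\<close>

lemma exists_hexagon_cosh:
  fixes c0 c1 c2 :: real
  assumes c: "c0 > 1" "c1 > 1" "c2 > 1"
  obtains p where "right_angled_hexagon p" "lorentz (p 3) (p 4) = - c0"
    "lorentz (p 5) (p 0) = - c1" "lorentz (p 1) (p 2) = - c2"
proof -
  obtain v0 v1 v2 :: "real^3" where v:
    "lorentz v0 v0 = 1" "lorentz v1 v1 = 1" "lorentz v2 v2 = 1"
    "lorentz v0 v1 = - c2" "lorentz v0 v2 = - c1" "lorentz v1 v2 = - c0"
    and v3: "v0$3 = 0" "v1$3 > 0" "v2$3 > 0"
    using exists_normals_with_products[OF c] by blast
  have v': "lorentz v1 v0 = - c2" "lorentz v2 v0 = - c1" "lorentz v2 v1 = - c0"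
    using v by (simp_all add: lorentz_commute)
  define s0 s1 s2 where "s0 = sqrt (c0\<^sup>2 - 1)" and "s1 = sqrt (c1\<^sup>2 - 1)" and "s2 = sqrt (c2\<^sup>2 - 1)"
  have "c0\<^sup>2 > 1" "c1\<^sup>2 > 1" "c2\<^sup>2 > 1" using c by simp_all
  then have s: "s0 > 0" "s1 > 0" "s2 > 0" and s': "s0\<^sup>2 = c0\<^sup>2 - 1" "s1\<^sup>2 = c1\<^sup>2 - 1" "s2\<^sup>2 = c2\<^sup>2 - 1"
    by (simp_all add: s0_def s1_def s2_def)
  define D where "D = hexagon_gram c0 c1 c2"
  have D: "D > 0" unfolding D_def using c by (rule hexagon_gram_pos)
  define p0 p1 p2 p3 p4 p5 where "p0 = foot c1 v0 v2" and "p1 = foot c2 v0 v1" and "p2 = foot c2 v1 v0"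
    and "p3 = foot c0 v1 v2" and "p4 = foot c0 v2 v1" and "p5 = foot c1 v2 v0"
  note p_defs = p0_def p1_def p2_def p3_def p4_def p5_def
  note products =
    foot_products[OF v(1,2,4,5,6) c(3)] foot_products[OF v(2,1) v'(1) v(6,5) c(3)]
    foot_products[OF v(1,3,5,4) v'(3) c(2)] foot_products[OF v(3,1) v'(2,3) v(4) c(2)]
    foot_products[OF v(2,3,6) v'(1,2) c(1)] foot_products[OF v(3,2) v'(3,2,1) c(1)]
  note products' = products[folded p_defs s0_def s1_def s2_def]
  \<comment> \<open>Normals of the red sides: positive multiples of the basis dual to \<open>v0\<close>, \<open>v1\<close>, \<open>v2\<close>.\<close>
  define w0 w1 w2 where "w0 = s0\<^sup>2 *\<^sub>R v0 - (c2 + c0 * c1) *\<^sub>R v1 - (c1 + c2 * c0) *\<^sub>R v2"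
    and "w1 = s1\<^sup>2 *\<^sub>R v1 - (c0 + c1 * c2) *\<^sub>R v2 - (c2 + c0 * c1) *\<^sub>R v0"
    and "w2 = s2\<^sup>2 *\<^sub>R v2 - (c1 + c2 * c0) *\<^sub>R v0 - (c0 + c1 * c2) *\<^sub>R v1"
  \<comment> \<open>The coefficients are the negated cofactors of the Gram matrix of the
    \<open>v\<close>, whose determinant is \<open>- D\<close>.\<close>
  have w: "lorentz w0 v0 = D" "lorentz w0 v1 = 0" "lorentz w0 v2 = 0"
    "lorentz w1 v0 = 0" "lorentz w1 v1 = D" "lorentz w1 v2 = 0"
    "lorentz w2 v0 = 0" "lorentz w2 v1 = 0" "lorentz w2 v2 = D"
    unfolding w0_def w1_def w2_def s' D_def hexagon_gram_def
    by (simp_all add: lorentz_bilinear v v' power2_eq_square algebra_simps)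
  have ww: "lorentz w0 w0 = s0\<^sup>2 * D" "lorentz w1 w1 = s1\<^sup>2 * D" "lorentz w2 w2 = s2\<^sup>2 * D"
  proof -
    have "lorentz w0 (s0\<^sup>2 *\<^sub>R v0 - (c2 + c0 * c1) *\<^sub>R v1 - (c1 + c2 * c0) *\<^sub>R v2) = s0\<^sup>2 * D"
      "lorentz w1 (s1\<^sup>2 *\<^sub>R v1 - (c0 + c1 * c2) *\<^sub>R v2 - (c2 + c0 * c1) *\<^sub>R v0) = s1\<^sup>2 * D"
      "lorentz w2 (s2\<^sup>2 *\<^sub>R v2 - (c1 + c2 * c0) *\<^sub>R v0 - (c0 + c1 * c2) *\<^sub>R v1) = s2\<^sup>2 * D"
      by (simp_all only: lorentz_bilinear w mult_zero_right diff_zero)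
    then show "lorentz w0 w0 = s0\<^sup>2 * D" "lorentz w1 w1 = s1\<^sup>2 * D" "lorentz w2 w2 = s2\<^sup>2 * D"
      by (simp_all only: flip: w0_def w1_def w2_def)
  qed
  define p :: "6 \<Rightarrow> real^3" where
    "p k = (if k = 0 then p0 else if k = 1 then p1 else if k = 2 then p2 else if k = 3 then p3
      else if k = 4 then p4 else p5)" for k
  \<comment> \<open>The \<open>v\<close> point outwards, hence the minus signs; the sides 1, 3, 5
    are the red edges 2, 0, 1.\<close>
  define n :: "6 \<Rightarrow> real^3" where
    "n k = (if k = 0 then - v0 else if k = 1 then w2 else if k = 2 then - v1 else if k = 3 then w0
      else if k = 4 then - v2 else w1)" for k
  have uminus: "lorentz (- x) y = - lorentz x y" "lorentz y (- x) = - lorentz y x" for x y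
    by (simp_all add: lorentz_def)
  have norm: "lorentz p0 p0 = -1" "lorentz p1 p1 = -1" "lorentz p2 p2 = -1"
    "lorentz p3 p3 = -1" "lorentz p4 p4 = -1" "lorentz p5 p5 = -1"
    by (simp_all only: products')
  \<comment> \<open>Each foot involves \<open>v1\<close> or \<open>v2\<close>, so
    \<open>v0$3 = 0\<close> does no harm.\<close>
  have upper: "p0$3 > 0" "p1$3 > 0" "p2$3 > 0" "p3$3 > 0" "p4$3 > 0" "p5$3 > 0"
    unfolding p_defs foot_def s0_def[symmetric] s1_def[symmetric] s2_def[symmetric]
    using v3 c s by (simp_all add: add_pos_pos)
  have hyp: "p0 \<in> hyp_plane" "p1 \<in> hyp_plane" "p2 \<in> hyp_plane"
    "p3 \<in> hyp_plane" "p4 \<in> hyp_plane" "p5 \<in> hyp_plane"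
    by (simp_all only: hyp_plane_def mem_Collect_eq norm upper simp_thms)
  have right: "right_angle p5 p0 p1" "right_angle p0 p1 p2" "right_angle p1 p2 p3"
    "right_angle p2 p3 p4" "right_angle p3 p4 p5" "right_angle p4 p5 p0"
    using right_angle_foot[OF v(1,3,5,4) v'(3) c(2), folded p_defs, OF hyp(1)]
      right_angle_foot[OF v(1,2,4,5,6) c(3), folded p_defs, OF hyp(2)]
      right_angle_foot[OF v(2,1) v'(1) v(6,5) c(3), folded p_defs, OF hyp(3)]
      right_angle_foot[OF v(2,3,6) v'(1,2) c(1), folded p_defs, OF hyp(4)]
      right_angle_foot[OF v(3,2) v'(3,2,1) c(1), folded p_defs, OF hyp(5)]
      right_angle_foot[OF v(3,1) v'(2,3) v(4) c(2), folded p_defs, OF hyp(6)]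
    by (simp_all only: right_angle_commute[of p5 p0 p1] right_angle_commute[of p1 p2 p3]
        right_angle_commute[of p3 p4 p5])
  have on_black: "lorentz v0 p0 = 0" "lorentz v0 p1 = 0" "lorentz v1 p2 = 0" "lorentz v1 p3 = 0"
    "lorentz v2 p4 = 0" "lorentz v2 p5 = 0"
    by (simp_all only: products')
  have on_red: "lorentz w2 p1 = 0" "lorentz w2 p2 = 0"
    "lorentz w0 p3 = 0" "lorentz w0 p4 = 0" "lorentz w1 p5 = 0" "lorentz w1 p0 = 0"
    by (simp_all add: p_defs foot_def lorentz_bilinear w)
  have black: "lorentz v0 p2 < 0" "lorentz v0 p3 < 0" "lorentz v0 p4 < 0" "lorentz v0 p5 < 0"
    "lorentz v1 p4 < 0" "lorentz v1 p5 < 0" "lorentz v1 p0 < 0" "lorentz v1 p1 < 0"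
    "lorentz v2 p0 < 0" "lorentz v2 p1 < 0" "lorentz v2 p2 < 0" "lorentz v2 p3 < 0"
  proof -
    have "- (x + y * z) / t < 0" if "x > 1" "y > 1" "z > 1" "t > 0" for x y z t :: real
    proof -
      have "x + y * z > 0" using that by (simp add: add_pos_pos)
      then show ?thesis using that by (simp add: divide_neg_pos)
    qed
    from this[OF c(1,2,3)] this[OF c(2,1,3)] this[OF c(3,1,2)] this[OF c(1,3,2)] this[OF c(2,3,1)] this[OF c(3,2,1)] s
    show "lorentz v0 p2 < 0" "lorentz v0 p3 < 0" "lorentz v0 p4 < 0" "lorentz v0 p5 < 0"
      "lorentz v1 p4 < 0" "lorentz v1 p5 < 0" "lorentz v1 p0 < 0" "lorentz v1 p1 < 0"
      "lorentz v2 p0 < 0" "lorentz v2 p1 < 0" "lorentz v2 p2 < 0" "lorentz v2 p3 < 0"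
      by (simp_all only: products' neg_less_0_iff_less)
  qed
  have red: "lorentz w2 p3 > 0" "lorentz w2 p4 > 0" "lorentz w2 p5 > 0" "lorentz w2 p0 > 0"
    "lorentz w0 p5 > 0" "lorentz w0 p0 > 0" "lorentz w0 p1 > 0" "lorentz w0 p2 > 0"
    "lorentz w1 p1 > 0" "lorentz w1 p2 > 0" "lorentz w1 p3 > 0" "lorentz w1 p4 > 0"
    unfolding p_defs foot_def s0_def[symmetric] s1_def[symmetric] s2_def[symmetric]
    using s c D by (simp_all add: lorentz_bilinear w)
  have p: "p 0 = p0" "p 1 = p1" "p 2 = p2" "p 3 = p3" "p 4 = p4" "p 5 = p5"
    by (simp_all add: p_def)
  have n: "n 0 = - v0" "n 1 = w2" "n 2 = - v1" "n 3 = w0" "n 4 = - v2" "n 5 = w1"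
    by (simp_all add: n_def)
  have step: "(0 :: 6) - 1 = 5" "(1 :: 6) - 1 = 0" "(2 :: 6) - 1 = 1" "(3 :: 6) - 1 = 2" "(4 :: 6) - 1 = 3"
    "(5 :: 6) - 1 = 4" "(0 :: 6) + 1 = 1" "(1 :: 6) + 1 = 2" "(2 :: 6) + 1 = 3" "(3 :: 6) + 1 = 4"
    "(4 :: 6) + 1 = 5" "(5 :: 6) + 1 = 0"
    by simp_all
  have "right_angled_hexagon p"
  proof (rule right_angled_hexagonI[where n = n])
    have "\<forall>k. p k \<in> hyp_plane" unfolding forall_6 p using hyp by blast
    then show "p k \<in> hyp_plane" for k ..
    have "\<forall>k. right_angle (p (k - 1)) (p k) (p (k + 1))"
      unfolding forall_6 step p using right by blast
    then show "right_angle (p (k - 1)) (p k) (p (k + 1))" for k ..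
    have "\<forall>k. lorentz (n k) (p k) = 0 \<and> lorentz (n k) (p (k + 1)) = 0 \<and> lorentz (n k) (n k) > 0"
      unfolding forall_6 step p n uminus on_black on_red ww v using s D by simp
    then show "lorentz (n k) (p k) = 0" "lorentz (n k) (p (k + 1)) = 0" "lorentz (n k) (n k) > 0" for k
      by simp_all
    have "\<forall>k m. m \<notin> {k, k + 1} \<longrightarrow> lorentz (n k) (p m) > 0"
      unfolding forall_6 step p n uminus using black red by simp
    then show "lorentz (n k) (p m) > 0" if "m \<notin> {k, k + 1}" for k m
      using that by blast
  qed
  then show thesis
    by (rule that) (simp_all add: p products')
qed

text \<open>Supplies the witness for the \<open>SOME\<close> in \<open>face_hexagon\<close>.\<close>

lemma exists_right_angled_hexagon:
  fixes l :: "3 \<Rightarrow> real"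
  assumes "\<And>i. l i > 0"
  shows "\<exists>p. right_angled_hexagon p \<and> (\<forall>i. red_length p i = l i)"
proof -
  have "cosh (l i) > 1" for i using cosh_real_strict_mono[of 0 "l i"] assms[of i] by simp
  then obtain p where p: "right_angled_hexagon p" "lorentz (p 3) (p 4) = - cosh (l 0)"
    "lorentz (p 5) (p 0) = - cosh (l 1)" "lorentz (p 1) (p 2) = - cosh (l 2)"
    using exists_hexagon_cosh by blast
  have "red_length p i = l i" for i
    using exhaust_3[of i] p(2-4) assms[of i]
    by (auto simp: red_length_def black_start_def hyp_dist_def numeral_mod_6 numeral_mod_3
        arcosh_cosh_real less_imp_le)
  with p(1) show ?thesis by blast
qed

lemma black_length_eq:
  assumes "right_angled_hexagon p" and "\<And>i. red_length p i = l i"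
  shows "black_length p i = opposite_side (cosh (l i)) (cosh (l (i + 1))) (cosh (l (i + 2)))"
proof -
  have hyp: "p k \<in> hyp_plane" for k using assms by (simp add: right_angled_hexagon_def)
  have cosh: "cosh (l i) = - lorentz (p (black_start i + 3)) (p (black_start i + 4))" for i
    using cosh_hyp_dist[OF hyp hyp] by (simp add: red_length_def flip: assms(2))
  show ?thesis
    using hexagon_cosine_law[OF assms(1), of "black_start i"] exhaust_3[of i]
    unfolding cosh by (auto simp: black_length_def black_start_def numeral_mod_6 numeral_mod_3)
qed

section \<open>Rigidity\<close>

lemma equiv_boundary_relation: "equiv UNIV (boundary_relation T)"
  unfolding boundary_relation_def
  by (intro equivI refl_rtrancl trans_rtrancl sym_rtrancl sym_Un_converse) simp

lemma boundary_component_eq_if_adjacent: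
  assumes "(a, b) \<in> arc_adjacency T"
  shows "boundary_component T a = boundary_component T b"
proof -
  have "(a, b) \<in> boundary_relation T" unfolding boundary_relation_def using assms by blast
  then show ?thesis unfolding boundary_component_def by (rule equiv_class_eq[OF equiv_boundary_relation])
qed

lemma boundary_components_eq_range: "boundary_components T = range (boundary_component T)"
  by (auto simp: boundary_components_def boundary_component_def quotient_def)

lemma boundary_component_eq_iff:
  assumes "b \<in> boundary_components T"
  shows "boundary_component T a = b \<longleftrightarrow> a \<in> b"
proof -
  obtain c where c: "b = boundary_component T c" using assms boundary_components_eq_range by blast
  show ?thesis
    unfolding c boundary_component_def eq_commute[of "boundary_relation T `` {a}"]
    by (simp add: eq_equiv_class_iff[OF equiv_boundary_relation])
qed

text \<open>\<open>cosh_edge_length\<close> reads the ends off an arbitrary representative;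
  exchanging the ends is harmless because its formula is symmetric.\<close>

lemma boundary_components_of_red_edge:
  assumes "ideal_triangulation T" and "h \<in> edge_class T h0"
  shows "boundary_component T (start_arc h) = boundary_component T (start_arc h0) \<and>
      boundary_component T (end_arc h) = boundary_component T (end_arc h0) \<or>
    boundary_component T (start_arc h) = boundary_component T (end_arc h0) \<and>
      boundary_component T (end_arc h) = boundary_component T (start_arc h0)"
proof (cases "crossed T h0")
  case True
  then have "(start_arc h0, end_arc (glue T h0)) \<in> arc_adjacency T"
    "(end_arc h0, start_arc (glue T h0)) \<in> arc_adjacency T"
    unfolding arc_adjacency_def by - (rule UN_I[of h0], rule UNIV_I, simp)+
  then show ?thesis
    using assms(2) by (auto simp: edge_class_def dest!: boundary_component_eq_if_adjacent)
next
  case False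
  then have "(start_arc h0, start_arc (glue T h0)) \<in> arc_adjacency T"
    "(end_arc h0, end_arc (glue T h0)) \<in> arc_adjacency T"
    unfolding arc_adjacency_def by - (rule UN_I[of h0], rule UNIV_I, simp)+
  then show ?thesis
    using assms(2) by (auto simp: edge_class_def dest!: boundary_component_eq_if_adjacent)
qed

section \<open>From conformal factors to angle coordinates\<close>

definition arc_angle :: "'f triangulation \<Rightarrow> ('f arc set \<Rightarrow> real) \<Rightarrow> 'f \<Rightarrow> 3 \<Rightarrow> real" where
  "arc_angle T u f i = arctan (exp (u (boundary_component T (f, i))))"

lemma arc_angle_bounds: "0 < arc_angle T u f i" "arc_angle T u f i < pi / 2"
  unfolding arc_angle_def by (simp, rule arctan_ubound)

lemma edge_cosh_arctan_exp:
  "edge_cosh \<eta> (arctan (exp a)) (arctan (exp b))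
    = exp (a + b) + \<eta> * sqrt ((1 + exp (2 * a)) * (1 + exp (2 * b)))"
  by (simp add: edge_cosh_def cos_arctan tan_arctan exp_add exp_double real_sqrt_mult)

lemma cosh_edge_length_eq:
  assumes "ideal_triangulation T"
  shows "cosh_edge_length T \<eta> u (edge_class T (f, i))
    = face_cosh (\<lambda>i. \<eta> (edge_class T (f, i))) (arc_angle T u f) i"
proof -
  define h where "h = (SOME h. h \<in> edge_class T (f, i))"
  have "h \<in> edge_class T (f, i)"
    unfolding h_def by (rule someI[of _ "(f, i)"]) (simp add: edge_class_def)
  from boundary_components_of_red_edge[OF assms this]
  show ?thesis
    unfolding cosh_edge_length_def h_def[symmetric] Let_def face_cosh_def arc_angle_def edge_cosh_arctan_exp
    by (auto simp: start_arc_def end_arc_def add.commute mult.commute)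
qed

lemma black_length_face_hexagon:
  fixes T :: "'f::finite triangulation"
  assumes T: "ideal_triangulation T" and u: "discrete_conformal_structure T \<eta> u"
  shows "black_length (face_hexagon T (conformal_metric T \<eta> u) f) i
    = face_side (\<lambda>i. \<eta> (edge_class T (f, i))) (arc_angle T u f) i"
    and "face_cosh (\<lambda>i. \<eta> (edge_class T (f, i))) (arc_angle T u f) i > 1"
proof -
  define c where "c = face_cosh (\<lambda>i. \<eta> (edge_class T (f, i))) (arc_angle T u f)"
  define l where "l i = conformal_metric T \<eta> u (edge_class T (f, i))" for i
  have c: "cosh_edge_length T \<eta> u (edge_class T (f, i)) = c i" for i
    unfolding c_def by (rule cosh_edge_length_eq[OF T])
  have gt: "c i > 1" for i
    using u by (auto simp: discrete_conformal_structure_def edges_def simp flip: c)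
  then show "face_cosh (\<lambda>i. \<eta> (edge_class T (f, i))) (arc_angle T u f) i > 1"
    by (simp add: c_def)
  have l: "l i > 0" for i
    using u by (auto simp: discrete_conformal_structure_def discrete_hyperbolic_metric_def edges_def l_def)
  have cosh: "cosh (l i) = c i" for i
    using gt[of i] by (simp add: l_def conformal_metric_def c)
  let ?p = "face_hexagon T (conformal_metric T \<eta> u) f"
  have "right_angled_hexagon ?p \<and> (\<forall>i. red_length ?p i = l i)"
    unfolding face_hexagon_def l_def[symmetric]
    by (rule someI_ex[OF exists_right_angled_hexagon[OF l]])
  then have "black_length ?p i = opposite_side (cosh (l i)) (cosh (l (i + 1))) (cosh (l (i + 2)))"
    by (intro black_length_eq) auto
  then show "black_length ?p i = face_side (\<lambda>i. \<eta> (edge_class T (f, i))) (arc_angle T u f) i"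
    by (simp add: cosh face_side_def c_def)
qed

text \<open>The components partition the arcs, being the fibres of
  \<open>boundary_component\<close>, so a sum over components becomes one over faces.\<close>

lemma sum_curvature_mult:
  fixes T :: "'f::finite triangulation"
  shows "(\<Sum>b\<in>boundary_components T. curvature T l b * x b)
    = (\<Sum>f\<in>UNIV. \<Sum>i\<in>UNIV. black_length (face_hexagon T l f) i * x (boundary_component T (f, i)))"
proof -
  let ?h = "\<lambda>(f, i). black_length (face_hexagon T l f) i * x (boundary_component T (f, i))"
  have "curvature T l b * x b = sum ?h {a \<in> UNIV. boundary_component T a = b}"
    if b: "b \<in> boundary_components T" for b
  proof -
    have "{a \<in> UNIV. boundary_component T a = b} = b"
      using boundary_component_eq_iff[OF b] by auto
    moreover have "boundary_component T a = b" if "a \<in> b" for a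
      using that boundary_component_eq_iff[OF b] by simp
    then have "curvature T l b * x b = sum ?h b"
      unfolding curvature_def sum_distrib_right by (intro sum.cong) auto
    ultimately show ?thesis by simp
  qed
  then have "(\<Sum>b\<in>boundary_components T. curvature T l b * x b)
    = (\<Sum>b\<in>boundary_components T. sum ?h {a \<in> UNIV. boundary_component T a = b})"
    by (rule sum.cong[OF refl])
  also have "\<dots> = sum ?h UNIV"
    by (rule sum.group) (auto simp: boundary_components_eq_range)
  also have "\<dots> = (\<Sum>f\<in>UNIV. \<Sum>i\<in>UNIV. black_length (face_hexagon T l f) i * x (boundary_component T (f, i)))"
    by (simp add: sum.cartesian_product)
  finally show ?thesis .
qed

theorem theorem1p1:
  fixes T :: "'f::finite triangulation"
    and \<eta> :: "'f red_edge set \<Rightarrow> real"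
    and u u' :: "'f arc set \<Rightarrow> real"
  assumes "ideal_triangulation T"
    and "\<forall>e\<in>edges T. \<eta> e > -1"
    and "\<forall>f. \<forall>i. \<eta> (edge_class T (f, i)) + \<eta> (edge_class T (f, i + 1)) * \<eta> (edge_class T (f, i + 2)) \<ge> 0"
    and "discrete_conformal_structure T \<eta> u"
    and "discrete_conformal_structure T \<eta> u'"
    and "\<forall>b\<in>boundary_components T.
           curvature T (conformal_metric T \<eta> u) b = curvature T (conformal_metric T \<eta> u') b"
  shows "\<forall>b\<in>boundary_components T. u b = u' b"
proof -
  note T = assms(1) and u = assms(4) and u' = assms(5)
  define \<eta>f where "\<eta>f f = (\<lambda>i. \<eta> (edge_class T (f, i)))" for f
  define s s' where "s = arc_angle T u" and "s' = arc_angle T u'"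
  define x where "x b = arctan (exp (u' b)) - arctan (exp (u b))" for b
  define G where "G f = (\<Sum>i\<in>UNIV. (face_side (\<eta>f f) (s' f) i - face_side (\<eta>f f) (s f) i) * (s' f i - s f i))" for f
  have x: "x (boundary_component T (f, i)) = s' f i - s f i" for f i
    by (simp add: x_def s_def s'_def arc_angle_def)
  have G_neg: "G f < 0" if "s f \<noteq> s' f" for f
    unfolding G_def
    by (rule face_side_strict_antimono)
      (use that arc_angle_bounds black_length_face_hexagon(2)[OF T u] black_length_face_hexagon(2)[OF T u']
        in \<open>simp_all add: \<eta>f_def s_def s'_def\<close>)
  \<comment> \<open>The test function \<open>x\<close> is the difference of the angles, which is
    what face-wise monotonicity pairs with.\<close>
  have "(\<Sum>b\<in>boundary_components T. curvature T (conformal_metric T \<eta> u') b * x b)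
    = (\<Sum>b\<in>boundary_components T. curvature T (conformal_metric T \<eta> u) b * x b)"
    by (rule sum.cong) (use assms(6) in auto)
  then have "(\<Sum>f\<in>UNIV. G f) = 0"
    unfolding sum_curvature_mult black_length_face_hexagon(1)[OF T u] black_length_face_hexagon(1)[OF T u'] x
    by (simp add: G_def s_def s'_def \<eta>f_def left_diff_distrib sum_subtractf)
  moreover have "G f \<le> 0" for f
    using G_neg[of f] by (cases "s f = s' f") (auto simp: G_def)
  ultimately have "G f = 0" for f
    using sum_nonneg_eq_0_iff[of UNIV "\<lambda>f. - G f"] by (simp add: sum_negf)
  then have "s f = s' f" for f using G_neg by fastforce
  then have "x (boundary_component T (f, i)) = 0" for f i by (simp add: x)
  \<comment> \<open>Every component contains an arc of some face.\<close>
  then have "x b = 0" if "b \<in> boundary_components T" for b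
    using that by (auto simp: boundary_components_eq_range)
  then show ?thesis by (simp add: x_def arctan_eq_iff)
qed

end
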